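(* Let $i,j,k$ be integers with $j>0$ and $0\le k<i$, and suppose the virtual link diagram $(i,j,k)$ has exactly one component, i.e. it is a virtual knot. Then $(i,j,k)$ is virtually null-homotopic and \[ \mathrm{vu}((i,j,k))=\frac{(i-1)(j-1)+k}{2}. \]
   Context: Virtual knots: a virtual knot diagram is a knot diagram some of whose crossings are virtual crossings, drawn with a small circle and carrying no over/under information; the other crossings are classical. Two diagrams represent the same virtual knot iff they are related by planar isotopy and generalized Reidemeister moves: classical R1–R3, virtual VR1–VR3, and the mixed move MR. A crossing change exchanges over- and understrand at a classical crossing. A virtual knot is virtually null-homotopic if generalized Reidemeister moves and crossing changes turn it into the unknot; for such a $K$, $\mathrm{vu}(K)$ (the virtual unknotting number) is the minimal number of crossing changes needed (with any number of generalized Reidemeister moves) to turn $K$ into the unknot. Braid conventions: braids on $i$ strands are drawn horizontally, oriented left to right, with positions $1,\dots,i$ numbered from top to bottom, and words are read left to right. The generator $\sigma_m$ is a classical (positive) crossing at which the strand in position $m$ moves to position $m+1$, passing over the strand moving from position $m+1$ to position $m$. $VB^1_{i,j}$ is the virtual braid obtained from $(\sigma_1\cdots\sigma_{i-1})^j$ by replacing the crossings of the first (left-most) block $\sigma_1\cdots\sigma_{i-1}$ by virtual crossings. In this block, the left-most overstrand passes over all other strands. $B_k=\sigma_k\sigma_{k-1}\cdots\sigma_1$, with $B_0$ the trivial braid. The diagram $(i,j,k)$ is the closure of the product $VB^1_{i,j}B_k$. *)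

theory Defs
  imports Complex_Main "HOL-Library.Multiset"
begin

text \<open>Virtual knots are modelled by signed Gauss codes (Goussarov--Polyak--Viro):
  a virtual knot diagram with one component is encoded by the cyclic sequence of the
  classical crossings met along the knot; each entry is (crossing label, over?, positive?).
  Virtual crossings do not appear. Generalized Reidemeister moves correspond exactly to
  the Gauss diagram moves below (rotation of the cyclic word, R1, R2, R3).\<close>

type_synonym xing = "nat \<times> bool \<times> bool"
type_synonym gcode = "xing list"

definition labels :: "gcode \<Rightarrow> nat set" where
  "labels D = fst ` set D"

definition sg :: "bool \<Rightarrow> int" where
  "sg b = (if b then 1 else -1)"

inductive rmove :: "gcode \<Rightarrow> gcode \<Rightarrow> bool" where
  rot: "rmove (x # xs) (xs @ [x])"
| r1: "a \<notin> labels (xs @ ys) \<Longrightarrow>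
       rmove (xs @ ys) (xs @ [(a, ov, s), (a, \<not> ov, s)] @ ys)"
| r2: "a \<notin> labels (xs @ ys @ zs) \<Longrightarrow> b \<notin> labels (xs @ ys @ zs) \<Longrightarrow> a \<noteq> b \<Longrightarrow>
       U = [(a, False, s), (b, False, \<not> s)] \<or> U = [(b, False, \<not> s), (a, False, s)] \<Longrightarrow>
       rmove (xs @ ys @ zs) (xs @ [(a, True, s), (b, True, \<not> s)] @ ys @ U @ zs)"
| r3: "distinct [a, b, c] \<Longrightarrow> a \<notin> labels (p0 @ p1 @ p2 @ p3) \<Longrightarrow>
       b \<notin> labels (p0 @ p1 @ p2 @ p3) \<Longrightarrow> c \<notin> labels (p0 @ p1 @ p2 @ p3) \<Longrightarrow>
       sg sc = sg sa * sg e1 * sg e3 \<Longrightarrow> sg sb = - sg sa * sg e2 * sg e3 \<Longrightarrow>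
       ST = (if e1 then [(b, True, sb), (a, True, sa)] else [(a, True, sa), (b, True, sb)]) \<Longrightarrow>
       SM = (if e2 then [(a, False, sa), (c, True, sc)] else [(c, True, sc), (a, False, sa)]) \<Longrightarrow>
       SB = (if e3 then [(c, False, sc), (b, False, sb)] else [(b, False, sb), (c, False, sc)]) \<Longrightarrow>
       mset [A, B, C] = mset [ST, SM, SB] \<Longrightarrow>
       rmove (p0 @ A @ p1 @ B @ p2 @ C @ p3) (p0 @ rev A @ p1 @ rev B @ p2 @ rev C @ p3)"

definition cc :: "nat \<Rightarrow> gcode \<Rightarrow> gcode" where
  "cc a D = map (\<lambda>(l, ov, s). if l = a then (l, \<not> ov, \<not> s) else (l, ov, s)) D"

inductive unk :: "gcode \<Rightarrow> nat \<Rightarrow> bool" where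
  triv: "unk [] 0"
| move: "rmove D D' \<or> rmove D' D \<Longrightarrow> unk D' n \<Longrightarrow> unk D n"
| change: "a \<in> labels D \<Longrightarrow> unk (cc a D) n \<Longrightarrow> unk D (Suc n)"

definition virtually_null_homotopic :: "gcode \<Rightarrow> bool" where
  "virtually_null_homotopic D = (\<exists>n. unk D n)"

definition vu :: "gcode \<Rightarrow> nat" where
  "vu D = (LEAST n. unk D n)"

text \<open>Virtual braids: Cl m = classical positive sigma_m, Vi m = virtual crossing at m,m+1.
  Positions are 1..i (top to bottom); at sigma_m the strand m -> m+1 passes over.\<close>
datatype bletter = Cl nat | Vi nat

fun pass :: "bletter list \<Rightarrow> nat \<Rightarrow> nat \<Rightarrow> gcode \<times> nat" where
  "pass [] t p = ([], p)"
| "pass (Vi m # w) t p =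
     pass w (Suc t) (if p = m then Suc m else if p = Suc m then m else p)"
| "pass (Cl m # w) t p =
     (let (e, q) = (if p = m then ([(t, True, True)], Suc m)
                    else if p = Suc m then ([(t, False, True)], m) else ([], p));
          (r, q') = pass w (Suc t) q
      in (e @ r, q'))"

fun trace :: "bletter list \<Rightarrow> nat \<Rightarrow> nat \<Rightarrow> gcode" where
  "trace w 0 p = []"
| "trace w (Suc n) p = fst (pass w 0 p) @ trace w n (snd (pass w 0 p))"

definition braid_perm :: "bletter list \<Rightarrow> nat \<Rightarrow> nat" where
  "braid_perm w p = snd (pass w 0 p)"

definition braid_word :: "nat \<Rightarrow> nat \<Rightarrow> nat \<Rightarrow> bletter list" where
  "braid_word i j k = map Vi [1..<i] @ concat (replicate (j - 1) (map Cl [1..<i]))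
                      @ map Cl (rev [1..<Suc k])"

text \<open>The closure has exactly one component iff the strand permutation is one i-cycle.\<close>
definition one_component :: "nat \<Rightarrow> nat \<Rightarrow> nat \<Rightarrow> bool" where
  "one_component i j k = (\<forall>p\<in>{1..i}. \<exists>n. (braid_perm (braid_word i j k) ^^ n) 1 = p)"

definition diagram :: "nat \<Rightarrow> nat \<Rightarrow> nat \<Rightarrow> gcode" where
  "diagram i j k = trace (braid_word i j k) i 1"

end

theory Submission
  imports Defs
begin

text \<open>The virtual block of the diagram acts as the shift of positions modulo \<open>i\<close>, so the diagram lives
  on a torus, in the homology class \<open>(i, 1)\<close>. A crossing between passages \<open>x\<close> and \<open>y\<close>
  has index \<open>\<plusminus>(y - x) \<noteq> 0\<close>. The sum of the signs of the crossings of nonzero index is invariant under the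
  Reidemeister moves and changes by at most 2 under a crossing change, which gives the lower bound.
  For the upper bound, make the diagram descending from the first passage. Each passage then has a level, all levels
  being distinct in the universal cover, and a closed path of arrangements of levels contracts by removing
  its peaks (with respect to a quadratic potential) one by one, using only R2 and R3. The signs weighted by the sign of the index
  sum up to an invariant of both the moves and crossing changes, so it vanishes; hence exactly half of the crossings were changed.\<close>

section \<open>Invariants of Gauss codes\<close>

text \<open>Levels are integers, not just passage numbers, because an event moved across the closing
  shift may wrap around the first passage; lowering both of its levels by one then keeps their
  comparison, hence the over/under choice. As crossings obey a linear order of levels, any three
  strands have a top, a middle and a bottom one, so every triangle met on the way admits R3. Level
  plus position is periodic, so its sum of squares over a period depends only on the arrangement. An
  exchange in which level \<open>x\<close> moves down past \<open>y\<close> changes it by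
  \<open>2 * (x - y)\<close>, never 0; hence every nonempty closed path has a peak with strictly
  lower neighbours. Both neighbours arise from the peak by exchanging an ascending pair. The two
  pairs coincide, are disjoint, or overlap in one position; the peak is then cut off by R2, by mere
  reordering, or by going the other way round the hexagon of arrangements of three levels. The last
  case lengthens the word by two, so the multiset of potentials, not the length, is what
  decreases.\<close>

text \<open>A crossing change flips both flags, so this sign belongs to the underlying flat curve:
  it tells from which side the other strand comes. At a positive braid crossing it is the change of
  position, +1 for the overstrand and -1 for the understrand.\<close>

definition wt :: "xing \<Rightarrow> int" where
  "wt e = sg (fst (snd e) = snd (snd e))"

definition height :: "gcode \<Rightarrow> int" where
  "height D = sum_list (map wt D)"

definition osgn :: "nat \<Rightarrow> xing \<Rightarrow> int" where
  "osgn a e = (if fst e = a then sg (fst (snd e)) else 0)"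

definition balance :: "nat \<Rightarrow> gcode \<Rightarrow> int" where
  "balance a D = sum_list (map (osgn a) D)"

text \<open>An entry at prefix height \<open>c\<close> contributes \<open>2 * c + wt e\<close>, negatively if it is an overpass, so
  \<open>hsum a 0 D\<close> is twice the index of the chord \<open>a\<close>. The doubling makes the contributions exactly
  antisymmetric under a crossing change, without any well-formedness assumption on the code.\<close>

fun hsum :: "nat \<Rightarrow> int \<Rightarrow> gcode \<Rightarrow> int" where
  "hsum a c [] = 0"
| "hsum a c (e # D) = hsum a (c + wt e) D - osgn a e * (2 * c + wt e)"

abbreviation ind :: "nat \<Rightarrow> gcode \<Rightarrow> int" where
  "ind a D \<equiv> hsum a 0 D"

text \<open>The sum runs over entries, so a crossing with two entries counts twice. It is used with
  the indicator of nonzero index for the lower bound and with \<open>sgn\<close> for the number of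
  changes.\<close>

definition jsum :: "(int \<Rightarrow> int) \<Rightarrow> gcode \<Rightarrow> int" where
  "jsum \<phi> D = sum_list (map (\<lambda>e. sg (snd (snd e)) * \<phi> (ind (fst e) D)) D)"

text \<open>What an induction from the empty code can maintain in place of well-formedness. Zero
  height and balances make the index independent of the base point; the multiplicity bound limits
  the effect of a crossing change.\<close>

definition regular :: "gcode \<Rightarrow> bool" where
  "regular D \<longleftrightarrow> height D = 0 \<and> (\<forall>a. balance a D = 0) \<and> (\<forall>a. count (mset (map fst D)) a \<le> 2)"

lemma sg_simps [simp]: "sg True = 1" "sg False = -1"
  by (simp_all add: sg_def)

lemma sg_not [simp]: "sg (\<not> b) = - sg b"
  by (simp add: sg_def)

lemma sg_eq_simps [simp]: "sg b = 1 \<longleftrightarrow> b" "sg b = -1 \<longleftrightarrow> \<not> b"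
  by (auto simp: sg_def)

lemma sg_sq [simp]: "sg b * sg b = 1"
  by (simp add: sg_def)

lemma height_append [simp]: "height (xs @ ys) = height xs + height ys"
  by (simp add: height_def)

lemma height_Cons [simp]: "height (e # ys) = wt e + height ys"
  by (simp add: height_def)

lemma height_Nil [simp]: "height [] = 0"
  by (simp add: height_def)

lemma balance_append [simp]: "balance a (xs @ ys) = balance a xs + balance a ys"
  by (simp add: balance_def)

lemma balance_Cons [simp]: "balance a (e # ys) = osgn a e + balance a ys"
  by (simp add: balance_def)

lemma balance_Nil [simp]: "balance a [] = 0"
  by (simp add: balance_def)

lemma hsum_append: "hsum a c (xs @ ys) = hsum a c xs + hsum a (c + height xs) ys"
  by (induction xs arbitrary: c) (auto simp: algebra_simps)

lemma hsum_offset: "hsum a (c + d) D = hsum a c D - 2 * d * balance a D"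
proof (induction D arbitrary: c)
  case (Cons e D)
  have "hsum a (c + d + wt e) D = hsum a (c + wt e) D - 2 * d * balance a D"
    using Cons.IH[of "c + wt e"] by (simp add: algebra_simps)
  then show ?case by (simp add: algebra_simps)
qed simp

lemma labels_simps [simp]:
  "labels [] = {}" "labels (e # D) = insert (fst e) (labels D)"
  "labels (xs @ ys) = labels xs \<union> labels ys" "labels (rev xs) = labels xs"
  by (auto simp: labels_def)

lemma osgn_other [simp]: "fst e \<noteq> a \<Longrightarrow> osgn a e = 0"
  by (simp add: osgn_def)

lemma hsum_fresh: "a \<notin> labels D \<Longrightarrow> hsum a c D = 0"
  by (induction D arbitrary: c) auto

lemma mset_height: "mset D = mset D' \<Longrightarrow> height D = height D'"
  unfolding height_def by (metis mset_map sum_mset_sum_list)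

lemma mset_balance: "mset D = mset D' \<Longrightarrow> balance a D = balance a D'"
  unfolding balance_def by (metis mset_map sum_mset_sum_list)

lemma regular_mset: "mset D = mset D' \<Longrightarrow> regular D = regular D'"
  unfolding regular_def using mset_height mset_balance by (metis mset_map)

lemma jsum_mset:
  assumes "mset D = mset D'" "\<And>a. ind a D = ind a D'"
  shows "jsum \<phi> D = jsum \<phi> D'"
proof -
  have "jsum \<phi> D = sum_mset (image_mset (\<lambda>e. sg (snd (snd e)) * \<phi> (ind (fst e) D)) (mset D))"
    by (simp add: jsum_def flip: sum_mset_sum_list)
  also have "\<dots> = jsum \<phi> D'"
    by (simp add: jsum_def assms flip: sum_mset_sum_list)
  finally show ?thesis .
qed

definition swap_change :: "nat \<Rightarrow> gcode \<Rightarrow> int" where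
  "swap_change a A = 2 * (osgn a (A ! 1) * wt (A ! 0) - osgn a (A ! 0) * wt (A ! 1))"

lemma hsum_rev:
  assumes "length A = 2"
  shows "hsum a c (rev A) = hsum a c A + swap_change a A"
proof -
  obtain e f where "A = [e, f]"
    using assms by (auto simp: numeral_2_eq_2 length_Suc_conv)
  then show ?thesis
    by (simp add: swap_change_def algebra_simps)
qed

lemma hsum_insert:
  assumes "height I = 0"
  shows "hsum a c (xs @ I @ ys) = hsum a c (xs @ ys) + hsum a (c + height xs) I"
  using assms by (simp add: hsum_append)

lemma jsum_cong_on:
  assumes "\<And>e. e \<in> set D \<Longrightarrow> ind (fst e) D = ind (fst e) D'"
  shows "jsum \<phi> D = sum_list (map (\<lambda>e. sg (snd (snd e)) * \<phi> (ind (fst e) D')) D)"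
  unfolding jsum_def using assms by (simp cong: map_cong)

lemma count_fresh: "a \<notin> labels D \<Longrightarrow> count (mset (map fst D)) a = 0"
  by (simp add: labels_def count_eq_zero_iff)

text \<open>The chord of an R1 has index 0, the two chords of an R2 have equal index and opposite
  signs, and R3 preserves all indices. Hence every weight \<open>\<phi>\<close> vanishing at 0 gives
  an invariant.\<close>

lemma rmove_invariant:
  assumes "rmove D D'" and \<phi>: "\<phi> 0 = 0"
  shows "regular D = regular D' \<and> (regular D \<longrightarrow> jsum \<phi> D = jsum \<phi> D')"
  using assms(1)
proof cases
  case (rot x xs)
  have m: "mset D = mset D'" using rot by simp
  have "jsum \<phi> D = jsum \<phi> D'" if r: "regular D"
  proof (rule jsum_mset[OF m])
    fix a
    have h: "height xs = - wt x" and b: "balance a xs = - osgn a x"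
      using r rot by (auto simp: regular_def add_eq_0_iff dest!: spec[of _ a])
    have "hsum a (0 + wt x) xs = hsum a 0 xs - 2 * wt x * balance a xs"
      by (rule hsum_offset)
    then show "ind a D = ind a D'"
      using rot h b by (simp add: hsum_append algebra_simps)
  qed
  then show ?thesis using regular_mset[OF m] by blast
next
  case (r1 a xs ys ov s)
  let ?I = "[(a, ov, s), (a, \<not> ov, s)]"
  have hI: "height ?I = 0" by (cases ov; cases s) (simp_all add: wt_def)
  have D': "D' = xs @ ?I @ ys" and D: "D = xs @ ys" and a: "a \<notin> labels xs" "a \<notin> labels ys"
    using r1 by auto
  have other: "ind l D = ind l D'" if "l \<noteq> a" for l
    unfolding D D' using hsum_insert[OF hI, of l 0 xs ys] that by simp
  have new: "ind a D' = 0"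
    unfolding D' using hsum_insert[OF hI, of a 0 xs ys] a
    by (cases ov; cases s) (simp_all add: hsum_fresh osgn_def wt_def hsum_append)
  have reg: "regular D = regular D'"
  proof -
    have "balance l D = balance l D'" for l
      unfolding D D' by (simp add: osgn_def)
    moreover have "height D = height D'" unfolding D D' using hI by simp
    moreover have "count (mset (map fst D')) l = (if l = a then 2 else count (mset (map fst D)) l)" for l
      unfolding D D' using a by (simp add: count_fresh labels_def count_eq_zero_iff)
    moreover have "count (mset (map fst D)) a = 0"
      unfolding D using a by (intro count_fresh) auto
    ultimately show ?thesis unfolding regular_def by (metis le0 order_refl)
  qed
  have e1: "jsum \<phi> D = sum_list (map (\<lambda>e. sg (snd (snd e)) * \<phi> (ind (fst e) D')) D)"
    by (rule jsum_cong_on, rule other) (use a D in \<open>auto simp: labels_def image_iff\<close>)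
  have "jsum \<phi> D = jsum \<phi> D'"
    unfolding e1 using new \<phi> by (simp add: jsum_def D D')
  then show ?thesis using reg by simp
next
  case (r2 a xs ys zs b U s)
  let ?I = "[(a, True, s), (b, True, \<not> s)]"
  have hI: "height ?I = 0" by (cases s) (simp_all add: wt_def)
  have hU: "height U = 0" using r2(6) by (cases s) (auto simp: wt_def)
  have D': "D' = xs @ ?I @ ys @ U @ zs" and D: "D = xs @ ys @ zs"
    and a: "a \<notin> labels xs" "a \<notin> labels ys" "a \<notin> labels zs"
    and b: "b \<notin> labels xs" "b \<notin> labels ys" "b \<notin> labels zs"
    using r2 by auto
  have lU: "labels U = {a, b}" using r2(6) by auto
  have ins: "hsum l 0 D' = hsum l 0 D + hsum l (height xs) ?I + hsum l (height xs + height ys) U" for l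
    unfolding D D' using hsum_insert[OF hI, of l 0 xs "ys @ U @ zs"] hsum_insert[OF hU, of l 0 "xs @ ys" zs]
    by simp
  have other: "ind l D = ind l D'" if "l \<noteq> a" "l \<noteq> b" for l
    unfolding ins using that lU by (simp add: hsum_fresh)
  have same: "ind a D' = ind b D'"
    unfolding ins using r2(5,6) a b unfolding D
    by (cases s) (auto simp: hsum_fresh osgn_def wt_def)
  have mU: "mset U = {#(a, False, s), (b, False, \<not> s)#}" using r2(6) by auto
  have bU: "balance l U = osgn l (a, False, s) + osgn l (b, False, \<not> s)" for l
    using r2(6) by auto
  have reg: "regular D = regular D'"
  proof -
    have "balance l D = balance l D'" for l
      unfolding D D' using bU[of l] by (simp add: osgn_def)
    moreover have "height D = height D'" unfolding D D' using hI hU by simp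
    moreover have "count (mset (map fst D')) l = (if l = a \<or> l = b then 2 else count (mset (map fst D)) l)" for l
      unfolding D D' using a b \<open>a \<noteq> b\<close> by (simp add: mU labels_def count_eq_zero_iff)
    moreover have "count (mset (map fst D)) a = 0" "count (mset (map fst D)) b = 0"
      unfolding D using a b by (simp_all add: labels_def count_eq_zero_iff)
    ultimately show ?thesis unfolding regular_def by (metis le0 order_refl)
  qed
  let ?g = "\<lambda>e :: xing. sg (snd (snd e)) * \<phi> (ind (fst e) D')"
  have e1: "jsum \<phi> D = sum_list (map ?g D)"
    by (rule jsum_cong_on, rule other) (use a b D in \<open>auto simp: labels_def image_iff\<close>)
  have "sum_list (map ?g U) = sum_mset (image_mset ?g (mset U))"
    by (simp flip: sum_mset_sum_list)
  also have "\<dots> = 0" unfolding mU using same by simp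
  finally have gU: "sum_list (map ?g U) = 0" .
  have gI: "sum_list (map ?g ?I) = 0" using same by simp
  have "jsum \<phi> D' = sum_list (map ?g (xs @ ?I @ ys @ U @ zs))"
    unfolding jsum_def using D' by simp
  also have "\<dots> = sum_list (map ?g D)"
    unfolding map_append sum_list_append gI gU D by simp
  finally have "jsum \<phi> D = jsum \<phi> D'" using e1 by simp
  then show ?thesis using reg by simp
next
  case (r3 a b c p0 p1 p2 p3 sc sa e1 e3 sb e2 ST SM SB A B C)
  have len: "length X = 2" if "X \<in># mset [ST, SM, SB]" for X
    using that r3(9-11) by (auto split: if_splits)
  have L: "length A = 2" "length B = 2" "length C = 2"
    using len[unfolded r3(12)[symmetric]] by auto
  have m: "mset D = mset D'" using r3(1,2) by simp
  have hrev: "height (rev X) = height X" for X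
    by (rule mset_height) simp
  have "ind l D = ind l D'" for l
  proof -
    have "ind l D' = ind l D + (swap_change l A + swap_change l B + swap_change l C)"
      unfolding r3(1,2) by (simp add: hsum_append hrev hsum_rev L)
    also have "swap_change l A + swap_change l B + swap_change l C
             = sum_mset (image_mset (swap_change l) (mset [A, B, C]))"
      by (simp add: algebra_simps)
    also have "\<dots> = swap_change l ST + swap_change l SM + swap_change l SB"
      unfolding r3(12) by (simp add: algebra_simps)
    \<comment> \<open>Each chord of the triangle lies on two of the strands, with a different
      partner on each; the sign conditions of \<open>r3\<close> make the two partner weights
      cancel.\<close>
    also have "\<dots> = 0"
      using r3(3,7,8) unfolding r3(9-11)
      by (cases sa; cases e1; cases e2; cases e3; simp add: swap_change_def osgn_def wt_def)
    finally show ?thesis by simp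
  qed
  from jsum_mset[OF m this] regular_mset[OF m] show ?thesis by blast
qed

section \<open>Effect of a crossing change on the invariants\<close>

definition flip_at :: "nat \<Rightarrow> xing \<Rightarrow> xing" where
  "flip_at a e = (if fst e = a then (a, \<not> fst (snd e), \<not> snd (snd e)) else e)"

lemma cc_eq_map: "cc a D = map (flip_at a) D"
  unfolding cc_def flip_at_def by (auto intro!: map_cong)

lemma flip_at_simps [simp]:
  "fst (flip_at a e) = fst e"
  "wt (flip_at a e) = wt e"
  "osgn l (flip_at a e) = (if l = a then - osgn l e else osgn l e)"
  "sg (snd (snd (flip_at a e))) = (if fst e = a then - sg (snd (snd e)) else sg (snd (snd e)))"
  by (auto simp: flip_at_def wt_def osgn_def)

lemma fst_cc: "map fst (cc a D) = map fst D"
  unfolding cc_eq_map by simp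

lemma hsum_cc: "hsum l c (cc a D) = (if l = a then - hsum l c D else hsum l c D)"
  unfolding cc_eq_map by (induction D arbitrary: c) auto

lemma regular_cc: "regular (cc a D) = regular D"
proof -
  have "height (cc a D) = height D"
    unfolding cc_eq_map by (induction D) auto
  moreover have "balance l (cc a D) = (if l = a then - balance l D else balance l D)" for l
    unfolding cc_eq_map by (induction D) auto
  then have "(\<forall>l. balance l (cc a D) = 0) = (\<forall>l. balance l D = 0)"
    by (metis neg_equal_0_iff_equal)
  ultimately show ?thesis
    unfolding regular_def fst_cc by simp
qed

text \<open>Sign and index of the changed chord are both negated, so its sign times
  \<open>\<phi> i\<close> becomes minus its sign times \<open>\<phi> (- i)\<close>: an odd weight
  notices nothing, an even one changes by twice the term.\<close>

lemma jsum_cc: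
  "jsum \<phi> (cc a D) = jsum \<phi> D
     - (\<phi> (ind a D) + \<phi> (- ind a D)) * sum_list (map (\<lambda>e. sg (snd (snd e))) (filter (\<lambda>e. fst e = a) D))"
proof -
  have "sum_list (map (\<lambda>e. sg (snd (snd e)) * \<phi> (ind (fst e) (cc a D))) (cc a E))
      = sum_list (map (\<lambda>e. sg (snd (snd e)) * \<phi> (ind (fst e) D)) E)
     - (\<phi> (ind a D) + \<phi> (- ind a D)) * sum_list (map (\<lambda>e. sg (snd (snd e))) (filter (\<lambda>e. fst e = a) E))" for E
    unfolding hsum_cc unfolding cc_eq_map by (induction E) (auto simp: algebra_simps)
  then show ?thesis unfolding jsum_def .
qed

lemma sum_list_sg_bound: "\<bar>sum_list (map (\<lambda>e. sg (f e)) xs)\<bar> \<le> int (length xs)"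
proof (induction xs)
  case (Cons x xs)
  then show ?case by (cases "f x") auto
qed simp

text \<open>The derivation is followed back from the unknot. The constant 4 comes from at most two
  entries per label, each changing the sum by at most 2.\<close>

lemma unk_invariants:
  assumes "unk D n"
  shows "regular D \<and> \<bar>jsum (\<lambda>x. of_bool (x \<noteq> 0)) D\<bar> \<le> 4 * int n \<and> jsum sgn D = 0"
  using assms
proof induction
  case triv
  show ?case by (simp add: regular_def jsum_def)
next
  case (move D D' n)
  then show ?case
    using rmove_invariant[of D D' sgn] rmove_invariant[of D' D sgn]
      rmove_invariant[of D D' "\<lambda>x. of_bool (x \<noteq> 0)"] rmove_invariant[of D' D "\<lambda>x. of_bool (x \<noteq> 0)"]
    by auto
next
  case (change a D n)
  let ?\<phi> = "\<lambda>x :: int. of_bool (x \<noteq> 0) :: int"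
  let ?S = "sum_list (map (\<lambda>e. sg (snd (snd e))) (filter (\<lambda>e. fst e = a) D))"
  have reg: "regular D" using change by (simp add: regular_cc)
  have "length (filter (\<lambda>e. fst e = a) D) = count (mset (map fst D)) a"
    by (induction D) auto
  also have "\<dots> \<le> 2" using reg by (simp add: regular_def)
  finally have "\<bar>?S\<bar> \<le> 2" using sum_list_sg_bound[of "\<lambda>e. snd (snd e)" "filter (\<lambda>e. fst e = a) D"] by simp
  moreover have "jsum ?\<phi> (cc a D) = jsum ?\<phi> D - 2 * ?\<phi> (ind a D) * ?S"
    unfolding jsum_cc by simp
  moreover have "jsum sgn (cc a D) = jsum sgn D"
    unfolding jsum_cc by (simp add: sgn_if)
  moreover have "\<bar>2 * ?\<phi> (ind a D) * ?S\<bar> \<le> 4"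
    using \<open>\<bar>?S\<bar> \<le> 2\<close> by auto
  ultimately show ?case using reg change.IH by auto
qed

section \<open>Codes of layered events\<close>

abbreviation req :: "gcode \<Rightarrow> gcode \<Rightarrow> bool" where
  "req \<equiv> equivclp rmove"

lemma rmove_req: "rmove D D' \<Longrightarrow> req D D'"
  by (rule r_into_equivclp)

lemma req_trans [trans]: "req A B \<Longrightarrow> req B C \<Longrightarrow> req A C"
  by (rule equivclp_trans)

lemma req_sym: "req A B \<Longrightarrow> req B A"
  by (rule equivclp_sym)

lemma unk_req: "req D D' \<Longrightarrow> unk D' n \<Longrightarrow> unk D n"
  by (induction rule: equivclp_induct) (auto intro: unk.move)

lemma req_rotate: "req (xs @ ys) (ys @ xs)"
proof (induction xs arbitrary: ys)
  case (Cons x xs)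
  have "req ((x # xs) @ ys) (xs @ (ys @ [x]))"
    using rmove_req[OF rmove.rot[of x "xs @ ys"]] by simp
  also have "req \<dots> ((ys @ [x]) @ xs)" by (rule Cons.IH)
  finally show ?case by simp
qed simp

text \<open>The move \<open>r2\<close> has its overpasses first; if the underpasses come first, the
  cyclic word is rotated.\<close>

lemma req_r2:
  assumes "a \<notin> labels (p @ q @ r)" "b \<notin> labels (p @ q @ r)" "a \<noteq> b"
    and X: "X = [(a, True, s), (b, True, \<not> s)]"
    and Y: "Y = [(a, False, s), (b, False, \<not> s)]"
    and "(A, B) = (X, Y) \<or> (A, B) = (Y, X)"
  shows "req (p @ A @ q @ B @ r) (p @ q @ r)"
  using assms(6)
proof
  assume "(A, B) = (X, Y)"
  then show ?thesis
    using req_sym[OF rmove_req[OF rmove.r2[OF assms(1-3), of Y s]]] X Y by simp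
next
  assume AB: "(A, B) = (Y, X)"
  have "req (p @ A @ q @ B @ r) ((q @ B @ r) @ (p @ A))"
    using req_rotate[of "p @ A" "q @ B @ r"] by simp
  also have "req \<dots> (q @ (r @ p) @ [])"
    using req_sym[OF rmove_req[OF rmove.r2[of a q "r @ p" "[]" b Y s]]] AB X Y assms(1-3)
    by (auto simp: labels_def)
  also have "req \<dots> (p @ q @ r)"
    using req_rotate[of "q @ r" p] by simp
  finally show ?thesis .
qed

text \<open>An event \<open>(a, x, y)\<close> is a crossing labelled \<open>a\<close> at which the strand of level \<open>x\<close>
  moves down past the strand of level \<open>y\<close>. Levels are integers; the \<open>r\<close>-th passage of the
  closed braid carries the levels congruent to \<open>r\<close> modulo the number \<open>n\<close> of strands.\<close>

type_synonym event = "nat \<times> int \<times> int"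

definition residue :: "nat \<Rightarrow> int \<Rightarrow> nat" where
  "residue n x = nat (x mod int n)"

text \<open>\<open>ov e\<close> says that the downward strand passes over, which by the braid
  convention is also the sign of the crossing.\<close>

definition entries :: "nat \<Rightarrow> (event \<Rightarrow> bool) \<Rightarrow> event \<Rightarrow> nat \<Rightarrow> gcode" where
  "entries n ov e r = (case e of (a, x, y) \<Rightarrow>
     (if residue n x = r then [(a, ov e, ov e)] else []) @
     (if residue n y = r then [(a, \<not> ov e, ov e)] else []))"

definition passage :: "nat \<Rightarrow> (event \<Rightarrow> bool) \<Rightarrow> event list \<Rightarrow> nat \<Rightarrow> gcode" where
  "passage n ov E r = concat (map (\<lambda>e. entries n ov e r) E)"

definition code :: "nat \<Rightarrow> (event \<Rightarrow> bool) \<Rightarrow> event list \<Rightarrow> gcode" where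
  "code n ov E = concat (map (passage n ov E) [0..<n])"

text \<open>The smaller level passes over. In the word of the given diagram all exchanges happen
  among positions \<open>1..n\<close>, whose levels are the passage numbers, so this choice is the
  descending diagram.\<close>

definition layered :: "event \<Rightarrow> bool" where
  "layered = (\<lambda>(a, x, y). x < y)"

lemma passage_simps [simp]:
  "passage n ov [] r = []"
  "passage n ov (e # E) r = entries n ov e r @ passage n ov E r"
  "passage n ov (E @ F) r = passage n ov E r @ passage n ov F r"
  by (simp_all add: passage_def)

lemma labels_entries: "labels (entries n ov e r) \<subseteq> {fst e}"
  by (auto simp: entries_def labels_def split: prod.splits if_splits)

lemma labels_passage: "labels (passage n ov E r) \<subseteq> fst ` set E"
  by (induction E) (auto dest!: subsetD[OF labels_entries])

lemma labels_code: "labels (code n ov E) \<subseteq> fst ` set E"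
proof -
  have "labels (concat (map (passage n ov E) rs)) \<subseteq> fst ` set E" for rs
    using labels_passage[of n ov E] by (induction rs) auto
  then show ?thesis by (simp add: code_def)
qed

section \<open>Isolating the passages touched by a local move\<close>

lemma upt_split:
  assumes "a \<le> b" "b < c"
  shows "[a..<c] = [a..<b] @ [b] @ [Suc b..<c]"
proof -
  have "[a..<c] = [a..<b] @ [b..<c]"
    using assms upt_add_eq_append[of a b "c - b"] by simp
  then show ?thesis using assms by (simp add: upt_conv_Cons)
qed

text \<open>The surrounding words are chosen before the local parts \<open>S\<close>, so that they
  are the same before and after a move; \<open>S = []\<close> yields the code against which
  freshness of labels is checked. The pair \<open>u'\<close>, \<open>v'\<close> records which
  passage comes first.\<close>

lemma concat_split2:
  fixes u v n :: nat
  assumes "u < n" "v < n" "u \<noteq> v"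
  obtains p q r u' v' where "(u', v') = (u, v) \<or> (u', v') = (v, u)"
    "\<forall>S. (\<forall>k. k \<notin> {u, v} \<longrightarrow> S k = []) \<longrightarrow>
       concat (map (\<lambda>k. P k @ S k @ Q k) [0..<n]) = p @ S u' @ q @ S v' @ (r :: 'a list)"
proof -
  have *: "\<exists>p q r. \<forall>S. (\<forall>k. k \<notin> {u, v} \<longrightarrow> S k = []) \<longrightarrow>
       concat (map (\<lambda>k. P k @ S k @ Q k) [0..<n]) = p @ S u @ q @ S v @ r"
    if "u < v" "v < n" for u v :: nat
  proof (intro exI allI impI)
    fix S :: "nat \<Rightarrow> 'a list" assume S: "\<forall>k. k \<notin> {u, v} \<longrightarrow> S k = []"
    let ?f = "\<lambda>k. P k @ S k @ Q k" and ?g = "\<lambda>k. P k @ Q k"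
    have fg: "concat (map ?f xs) = concat (map ?g xs)" if "set xs \<inter> {u, v} = {}" for xs
      using S that by (auto intro!: arg_cong[of _ _ concat])
    have rng: "[0..<n] = [0..<u] @ [u] @ [Suc u..<v] @ [v] @ [Suc v..<n]"
      using that upt_split[of 0 u n] upt_split[of "Suc u" v n] by simp
    show "concat (map ?f [0..<n]) =
        (concat (map ?g [0..<u]) @ P u) @ S u @ (Q u @ concat (map ?g [Suc u..<v]) @ P v) @ S v
        @ (Q v @ concat (map ?g [Suc v..<n]))"
      unfolding rng using S that fg[of "[0..<u]"] fg[of "[Suc u..<v]"] fg[of "[Suc v..<n]"] by simp
  qed
  show thesis
  proof (cases "u < v")
    case True
    from *[OF this assms(2)] obtain p q r where "\<forall>S. (\<forall>k. k \<notin> {u, v} \<longrightarrow> S k = []) \<longrightarrow>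
       concat (map (\<lambda>k. P k @ S k @ Q k) [0..<n]) = p @ S u @ q @ S v @ r" by (elim exE)
    then show thesis by (intro that[of u v p q r]) auto
  next
    case False
    then have "v < u" using assms by simp
    from *[OF this assms(1)] obtain p q r where "\<forall>S. (\<forall>k. k \<notin> {v, u} \<longrightarrow> S k = []) \<longrightarrow>
       concat (map (\<lambda>k. P k @ S k @ Q k) [0..<n]) = p @ S v @ q @ S u @ r" by (elim exE)
    then show thesis by (intro that[of v u p q r]) auto
  qed
qed

lemma concat_split3:
  fixes u v w n :: nat
  assumes "u < n" "v < n" "w < n" "distinct [u, v, w]"
  obtains p0 p1 p2 p3 u' v' w' where "mset [u', v', w'] = mset [u, v, w]"
    "\<forall>S. (\<forall>k. k \<notin> {u, v, w} \<longrightarrow> S k = []) \<longrightarrow>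
       concat (map (\<lambda>k. P k @ S k @ Q k) [0..<n]) = p0 @ S u' @ p1 @ S v' @ p2 @ S w' @ (p3 :: 'a list)"
proof -
  have *: "\<exists>p0 p1 p2 p3. \<forall>S. (\<forall>k. k \<notin> {u, v, w} \<longrightarrow> S k = []) \<longrightarrow>
       concat (map (\<lambda>k. P k @ S k @ Q k) [0..<n]) = p0 @ S u @ p1 @ S v @ p2 @ S w @ p3"
    if "u < v" "v < w" "w < n" for u v w :: nat
  proof (intro exI allI impI)
    fix S :: "nat \<Rightarrow> 'a list" assume S: "\<forall>k. k \<notin> {u, v, w} \<longrightarrow> S k = []"
    let ?f = "\<lambda>k. P k @ S k @ Q k" and ?g = "\<lambda>k. P k @ Q k"
    have fg: "concat (map ?f xs) = concat (map ?g xs)" if "set xs \<inter> {u, v, w} = {}" for xs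
      using S that by (auto intro!: arg_cong[of _ _ concat])
    have rng: "[0..<n] = [0..<u] @ [u] @ [Suc u..<v] @ [v] @ [Suc v..<w] @ [w] @ [Suc w..<n]"
      using that upt_split[of 0 u n] upt_split[of "Suc u" v n] upt_split[of "Suc v" w n] by simp
    show "concat (map ?f [0..<n]) =
        (concat (map ?g [0..<u]) @ P u) @ S u @ (Q u @ concat (map ?g [Suc u..<v]) @ P v) @ S v
        @ (Q v @ concat (map ?g [Suc v..<w]) @ P w) @ S w @ (Q w @ concat (map ?g [Suc w..<n]))"
      unfolding rng using S that fg[of "[0..<u]"] fg[of "[Suc u..<v]"] fg[of "[Suc v..<w]"] fg[of "[Suc w..<n]"]
      by simp
  qed
  note result = that
  have **: thesis if uvw: "u' < v'" "v' < w'" "w' < n" "mset [u', v', w'] = mset [u, v, w]" for u' v' w'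
  proof -
    from *[OF uvw(1-3)] obtain p0 p1 p2 p3 where
      1: "\<forall>S. (\<forall>k. k \<notin> {u', v', w'} \<longrightarrow> S k = []) \<longrightarrow>
       concat (map (\<lambda>k. P k @ S k @ Q k) [0..<n]) = p0 @ S u' @ p1 @ S v' @ p2 @ S w' @ p3" by (elim exE)
    have "set [u', v', w'] = set [u, v, w]" using uvw(4) by (rule mset_eq_setD)
    then have "{u', v', w'} = {u, v, w}" by simp
    from 1[unfolded this] show thesis by (rule result[OF uvw(4)])
  qed
  consider "u < v" "v < w" | "u < w" "w < v" | "v < u" "u < w" | "v < w" "w < u" | "w < u" "u < v" | "w < v" "v < u"
    using assms(4) by (metis distinct_length_2_or_more linorder_neqE_nat)
  then show thesis
    by cases (use **[of u v w] **[of u w v] **[of v u w] **[of v w u] **[of w u v] **[of w v u] assms(1-3)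
      in \<open>simp_all add: add_mset_commute\<close>)
qed


lemma code_middle:
  "code n ov (E @ F @ G) = concat (map (\<lambda>k. passage n ov E k @ passage n ov F k @ passage n ov G k) [0..<n])"
  by (auto simp: code_def intro!: arg_cong[of _ _ concat])

lemma passage_outside:
  assumes "\<And>a x y. (a, x, y) \<in> set F \<Longrightarrow> residue n x \<noteq> k \<and> residue n y \<noteq> k"
  shows "passage n ov F k = []"
  using assms by (induction F) (fastforce simp: entries_def)+

section \<open>R2 and R3 on events\<close>

lemma residue_less: "0 < n \<Longrightarrow> residue n x < n"
  by (simp add: residue_def nat_less_iff)

text \<open>Hypothesis \<open>sw\<close> says that the same strand is over at both crossings, which
  therefore have opposite signs, as R2 requires.\<close>

lemma req_cancel_events:
  assumes n: "0 < n" and xy: "residue n x \<noteq> residue n y"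
    and x': "residue n x' = residue n x" and y': "residue n y' = residue n y"
    and sw: "y' < x' \<longleftrightarrow> \<not> x < y"
    and fresh: "a \<notin> fst ` set (E @ G)" "b \<notin> fst ` set (E @ G)" "a \<noteq> b"
  shows "req (code n layered (E @ [(a, x, y), (b, y', x')] @ G)) (code n layered (E @ G))"
proof -
  let ?F = "[(a, x, y), (b, y', x')]"
  define s where "s = (x < y)"
  define S where "S = passage n layered ?F"
  obtain p q r u v where uv: "(u, v) = (residue n x, residue n y) \<or> (u, v) = (residue n y, residue n x)"
    and split: "\<forall>S. (\<forall>k. k \<notin> {residue n x, residue n y} \<longrightarrow> S k = []) \<longrightarrow>
      concat (map (\<lambda>k. passage n layered E k @ S k @ passage n layered G k) [0..<n]) = p @ S u @ q @ S v @ r"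
    by (rule concat_split2[OF residue_less[OF n] residue_less[OF n] xy,
          of "passage n layered E" "passage n layered G"])
  have code1: "code n layered (E @ ?F @ G) = p @ S u @ q @ S v @ r"
    unfolding code_middle S_def by (rule split[rule_format], rule passage_outside) (use x' y' in auto)
  have code0: "code n layered (E @ G) = p @ q @ r"
    using split[rule_format, of "\<lambda>_. []"] code_middle[of n layered E "[]" G] by simp
  have lab: "a \<notin> labels (p @ q @ r)" "b \<notin> labels (p @ q @ r)"
    using labels_code[of n layered "E @ G"] fresh unfolding code0 by auto
  have Sx: "S (residue n x) = [(a, s, s), (b, s, \<not> s)]" and Sy: "S (residue n y) = [(a, \<not> s, s), (b, \<not> s, \<not> s)]"
    using xy x' y' sw by (auto simp: S_def entries_def layered_def s_def)
  show ?thesis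
    unfolding code1 code0
    by (rule req_r2[OF lab fresh(3) refl refl, of _ _ s]) (use uv Sx Sy in \<open>cases s; auto\<close>)
qed

text \<open>Levels order the three strands linearly, so the triangle is never cyclic. Each of the
  three passages meets its two crossings in reverse order afterwards.\<close>

lemma req_triangle:
  assumes n: "0 < n" and d: "distinct [residue n x, residue n y, residue n z]"
    and lab: "distinct [a, b, c]" "a \<notin> fst ` set (E @ G)" "b \<notin> fst ` set (E @ G)" "c \<notin> fst ` set (E @ G)"
    and ord: "distinct [x, y, z]"
  shows "req (code n layered (E @ [(a, x, y), (b, x, z), (c, y, z)] @ G))
             (code n layered (E @ [(c, y, z), (b, x, z), (a, x, y)] @ G))"
proof -
  let ?F = "[(a, x, y), (b, x, z), (c, y, z)]"
  let ?x = "residue n x" and ?y = "residue n y" and ?z = "residue n z"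
  define S where "S = passage n layered ?F"
  obtain p0 p1 p2 p3 u v w where uvw: "mset [u, v, w] = mset [?x, ?y, ?z]"
    and split: "\<forall>S. (\<forall>k. k \<notin> {?x, ?y, ?z} \<longrightarrow> S k = []) \<longrightarrow>
      concat (map (\<lambda>k. passage n layered E k @ S k @ passage n layered G k) [0..<n])
      = p0 @ S u @ p1 @ S v @ p2 @ S w @ p3"
    by (rule concat_split3[OF residue_less[OF n] residue_less[OF n] residue_less[OF n] d,
          of "passage n layered E" "passage n layered G"])
  have S: "S ?x = [(a, x < y, x < y), (b, x < z, x < z)]" "S ?y = [(a, \<not> x < y, x < y), (c, y < z, y < z)]"
    "S ?z = [(b, \<not> x < z, x < z), (c, \<not> y < z, y < z)]"
    "\<And>k. k \<notin> {?x, ?y, ?z} \<Longrightarrow> S k = []"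
    using d by (auto simp: S_def entries_def layered_def)
  have rev: "passage n layered (rev ?F) k = rev (S k)" for k
    using d by (auto simp: S_def entries_def layered_def)
  have code1: "code n layered (E @ ?F @ G) = p0 @ S u @ p1 @ S v @ p2 @ S w @ p3"
    unfolding code_middle S_def[symmetric] by (rule split[rule_format], rule S(4))
  have code2: "code n layered (E @ rev ?F @ G) = p0 @ rev (S u) @ p1 @ rev (S v) @ p2 @ rev (S w) @ p3"
    unfolding code_middle rev by (rule split[rule_format]) (simp add: S(4))
  have code0: "code n layered (E @ G) = p0 @ p1 @ p2 @ p3"
    using split[rule_format, of "\<lambda>_. []"] code_middle[of n layered E "[]" G] by simp
  have fresh: "a \<notin> labels (p0 @ p1 @ p2 @ p3)" "b \<notin> labels (p0 @ p1 @ p2 @ p3)" "c \<notin> labels (p0 @ p1 @ p2 @ p3)"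
    using labels_code[of n layered "E @ G"] lab unfolding code0 by auto
  have "mset [S u, S v, S w] = image_mset S (mset [u, v, w])" by simp
  also have "\<dots> = mset [S ?x, S ?y, S ?z]" unfolding uvw by simp
  finally have ms: "mset [S u, S v, S w] = mset [S ?x, S ?y, S ?z]" .
  have "rmove (p0 @ S u @ p1 @ S v @ p2 @ S w @ p3) (p0 @ rev (S u) @ p1 @ rev (S v) @ p2 @ rev (S w) @ p3)"
  proof -
    \<comment> \<open>The smallest level is the top strand. In each case the first three labels
      passed to \<open>r3\<close> are the crossings top-middle, top-bottom and
      middle-bottom.\<close>
    consider "x < y" "y < z" | "x < z" "z < y" | "y < x" "x < z" | "y < z" "z < x" | "z < x" "x < y" | "z < y" "y < x"
      using ord by force
    then show ?thesis
    proof cases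
      case 1 show ?thesis
        by (rule rmove.r3[of a b c p0 p1 p2 p3 True True False False True True
            "S ?x" "S ?y" "S ?z" "S u" "S v" "S w"]) (use 1 lab fresh ms S in auto)
    next
      case 2 show ?thesis
        by (rule rmove.r3[of b a c p0 p1 p2 p3 False True True False True True
            "S ?x" "S ?z" "S ?y" "S u" "S v" "S w"]) (use 2 lab fresh ms S in auto)
    next
      case 3 show ?thesis
        by (rule rmove.r3[of a c b p0 p1 p2 p3 True False False True True True
            "S ?y" "S ?x" "S ?z" "S u" "S v" "S w"]) (use 3 lab fresh ms S in auto)
    next
      case 4 show ?thesis
        by (rule rmove.r3[of c a b p0 p1 p2 p3 False True True False False False
            "S ?y" "S ?z" "S ?x" "S u" "S v" "S w"]) (use 4 lab fresh ms S in auto)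
    next
      case 5 show ?thesis
        by (rule rmove.r3[of b c a p0 p1 p2 p3 True False False True False False
            "S ?z" "S ?x" "S ?y" "S u" "S v" "S w"]) (use 5 lab fresh ms S in auto)
    next
      case 6 show ?thesis
        by (rule rmove.r3[of c b a p0 p1 p2 p3 False False True True False False
            "S ?z" "S ?y" "S ?x" "S u" "S v" "S w"]) (use 6 lab fresh ms S in auto)
    qed
  qed
  then show ?thesis using rmove_req code1 code2 by simp
qed

section \<open>Words of exchanges and their states\<close>

lemma concat_shift:
  "concat (map (\<lambda>r. A r @ B r) [0..<n]) @ A n = A 0 @ concat (map (\<lambda>r. B r @ A (Suc r)) [0..<n])"
  by (induction n) auto

lemma residue_pred:
  assumes "r < n"
  shows "residue n (x - 1) = r \<longleftrightarrow> residue n x = (if Suc r = n then 0 else Suc r)"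
proof -
  have n: "0 < int n" using assms by simp
  have 1: "residue n z = r \<longleftrightarrow> int n dvd z - int r" if "r < n" for z r
  proof -
    have "residue n z = r \<longleftrightarrow> z mod int n = int r mod int n"
      using that n unfolding residue_def by auto
    then show ?thesis by (simp add: mod_eq_dvd_iff)
  qed
  show ?thesis
  proof (cases "Suc r = n")
    case True
    then have e: "x - 1 - int r = x - int n" by simp
    have "int n dvd x - int n \<longleftrightarrow> int n dvd x" by (simp add: dvd_diff_left_iff)
    then show ?thesis using True 1[of r "x - 1", unfolded e] 1[of 0 x] assms by simp
  next
    case False
    with assms have "Suc r < n" by simp
    then show ?thesis using 1[of r "x - 1"] 1[of "Suc r" x] assms False by (simp add: algebra_simps)
  qed
qed

text \<open>An entry at the start of a passage and an entry at the end of the preceding passage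
  stand at the same place of the cyclic word; only the entries of passage 0 really move, from the
  front to the end.\<close>

lemma req_code_rotate:
  assumes n: "0 < n"
  shows "req (code n layered ((a, x, y) # E)) (code n layered (E @ [(a, x - 1, y - 1)]))"
proof -
  define A where "A r = entries n layered (a, x, y) (if r = n then 0 else r)" for r
  have A': "entries n layered (a, x - 1, y - 1) r = A (Suc r)" if "r < n" for r
    using that by (auto simp: A_def entries_def layered_def residue_pred)
  have "code n layered ((a, x, y) # E) = concat (map (\<lambda>r. A r @ passage n layered E r) [0..<n])"
    by (auto simp: code_def A_def intro!: arg_cong[of _ _ concat])
  moreover have "code n layered (E @ [(a, x - 1, y - 1)]) = concat (map (\<lambda>r. passage n layered E r @ A (Suc r)) [0..<n])"
    by (auto simp: code_def A' intro!: arg_cong[of _ _ concat])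
  moreover have "A n = A 0" using n by (simp add: A_def)
  moreover have "A 0 @ concat (map (\<lambda>r. passage n layered E r @ A (Suc r)) [0..<n])
      = concat (map (\<lambda>r. A r @ passage n layered E r) [0..<n]) @ A n"
    by (rule concat_shift[symmetric])
  moreover obtain X where "concat (map (\<lambda>r. A r @ passage n layered E r) [0..<n]) = A 0 @ X"
    using n by (simp add: upt_conv_Cons)
  ultimately have "code n layered ((a, x, y) # E) = A 0 @ X"
    "code n layered (E @ [(a, x - 1, y - 1)]) = X @ A 0" by simp_all
  then show ?thesis using req_rotate by simp
qed

text \<open>Positions live in the universal cover of the torus, so all translates of a crossing are
  exchanged at once.\<close>

definition tau :: "nat \<Rightarrow> int \<Rightarrow> int \<Rightarrow> int" where
  "tau n m q = (if int n dvd q - m then q + 1 else if int n dvd q - m - 1 then q - 1 else q)"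

lemma dvd_shift1: "2 \<le> n \<Longrightarrow> int n dvd z \<Longrightarrow> \<not> int n dvd z + 1"
  "2 \<le> n \<Longrightarrow> int n dvd z \<Longrightarrow> \<not> int n dvd z - 1"
proof -
  have "\<not> int n dvd 1" if "2 \<le> n" using that by simp
  then show "2 \<le> n \<Longrightarrow> int n dvd z \<Longrightarrow> \<not> int n dvd z + 1" "2 \<le> n \<Longrightarrow> int n dvd z \<Longrightarrow> \<not> int n dvd z - 1"
    using dvd_add_right_iff[of "int n" z 1] dvd_diff_right_iff[of "int n" z 1] by auto
qed

lemma tau_tau [simp]: "2 \<le> n \<Longrightarrow> tau n m (tau n m q) = q"
  using dvd_shift1[of n "q - m"] dvd_shift1[of n "q - m - 1"]
  by (auto simp: tau_def algebra_simps)

lemma tau_simps [simp]: "tau n m m = m + 1" "2 \<le> n \<Longrightarrow> tau n m (m + 1) = m"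
  using dvd_shift1[of n 0] by (auto simp: tau_def)

lemma tau_other: "\<not> int n dvd q - m \<Longrightarrow> \<not> int n dvd q - m - 1 \<Longrightarrow> tau n m q = q"
  by (simp add: tau_def)

lemma tau_cong: "int n dvd m' - m \<Longrightarrow> tau n m' = tau n m"
proof
  fix q assume "int n dvd m' - m"
  then have "int n dvd q - m' \<longleftrightarrow> int n dvd q - m" "int n dvd q - m' - 1 \<longleftrightarrow> int n dvd q - m - 1"
    using dvd_add_left_iff[of "int n" "m' - m" "q - m'"] dvd_add_left_iff[of "int n" "m' - m" "q - m' - 1"]
    by (simp_all add: algebra_simps)
  then show "tau n m' q = tau n m q" by (simp add: tau_def)
qed

lemma tau_shift: "tau n (m + 1) q - 1 = tau n m (q - 1)"
  by (simp add: tau_def algebra_simps)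

lemma tau_period: "tau n m (q + int n) = tau n m q + int n"
proof -
  have "q + int n - m = (q - m) + int n" "q + int n - m - 1 = (q - m - 1) + int n" by simp_all
  then show ?thesis by (simp only: tau_def dvd_add_triv_right_iff) simp
qed

lemma tau_inj: "2 \<le> n \<Longrightarrow> inj (tau n m)"
  by (metis injI tau_tau)

text \<open>A lifted arrangement: \<open>M q\<close> is the level in position \<open>q\<close>. The
  period has slope -1 because one turn of the closed braid shifts the position by -1 and the level
  by +1.\<close>

definition state :: "nat \<Rightarrow> (int \<Rightarrow> int) \<Rightarrow> bool" where
  "state n M \<longleftrightarrow> inj M \<and> (\<forall>q. M (q + int n) = M q - int n)"

lemma state_tau: "2 \<le> n \<Longrightarrow> state n M \<Longrightarrow> state n (M \<circ> tau n m)"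
  unfolding state_def by (auto simp: tau_period intro: inj_compose tau_inj)

lemma state_mult: "state n M \<Longrightarrow> M (q + int n * k) = M q - int n * k"
proof (induction k rule: int_induct[of _ 0])
  case (step1 k)
  have "M (q + int n * (k + 1)) = M (q + int n * k + int n)" by (simp add: algebra_simps)
  also have "\<dots> = M (q + int n * k) - int n" using step1.prems by (simp only: state_def)
  finally show ?case using step1 by (simp add: algebra_simps)
next
  case (step2 k)
  have "M (q + int n * k) = M (q + int n * (k - 1) + int n)" by (simp add: algebra_simps)
  moreover have "M (q + int n * (k - 1) + int n) = M (q + int n * (k - 1)) - int n"
    using step2.prems by (simp only: state_def)
  ultimately show ?case using step2 by (simp add: algebra_simps)
qed simp

lemma state_cong: "state n M \<Longrightarrow> int n dvd q' - q \<Longrightarrow> M q' = M q - (q' - q)"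
  using state_mult[of n M q "(q' - q) div int n"] by simp

lemma residue_eq_iff: "0 < n \<Longrightarrow> residue n x = residue n y \<longleftrightarrow> int n dvd x - y"
  unfolding residue_def by (subst eq_nat_nat_iff) (simp_all add: mod_eq_dvd_iff[symmetric])

text \<open>If the levels differ by a multiple of \<open>n\<close>, some translate of
  \<open>q\<close> carries the level of \<open>p\<close>, and injectivity makes it equal to
  \<open>p\<close>.\<close>

lemma state_residue:
  assumes "0 < n" "state n M"
  shows "residue n (M p) = residue n (M q) \<longleftrightarrow> int n dvd p - q"
proof -
  have "int n dvd p - q" if "int n dvd M p - M q"
  proof -
    have "M (q - (M p - M q)) = M q + (M p - M q)"
      using state_cong[OF assms(2), of "q - (M p - M q)" q] that by (simp add: dvd_diff_commute)
    then have "q - (M p - M q) = p"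
      using assms(2) by (simp add: state_def inj_eq)
    then have "p - q = M q - M p" by simp
    then show ?thesis using that by (simp add: dvd_diff_commute)
  qed
  moreover have "int n dvd M p - M q" if "int n dvd p - q"
    using state_cong[OF assms(2) that] that by (simp add: dvd_diff_commute)
  ultimately show ?thesis using residue_eq_iff[OF assms(1)] by blast
qed

text \<open>For a state, \<open>M p + p\<close> has period \<open>n\<close>, so the choice of the
  period is immaterial; this makes the closing shift harmless.\<close>

definition potential :: "nat \<Rightarrow> (int \<Rightarrow> int) \<Rightarrow> nat" where
  "potential n M = nat (\<Sum>p\<in>{0..<int n}. (M p + p)\<^sup>2)"

lemma sum_shift_period:
  fixes g :: "int \<Rightarrow> int"
  assumes "\<And>q. g (q + int n) = g q"
  shows "(\<Sum>p\<in>{0..<int n}. g (p - 1)) = (\<Sum>p\<in>{0..<int n}. g p)"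
proof (cases n)
  case (Suc k)
  have "(\<Sum>p\<in>{0..<int n}. g (p - 1)) = (\<Sum>p\<in>{-1..<int n - 1}. g p)"
    by (rule sum.reindex_bij_witness[of _ "\<lambda>p. p + 1" "\<lambda>p. p - 1"]) auto
  also have "{-1..<int n - 1} = insert (-1) {0..<int n - 1}" using Suc by auto
  also have "sum g \<dots> = sum g (insert (int n - 1) {0..<int n - 1})"
    using assms[of "-1"] by simp
  also have "insert (int n - 1) {0..<int n - 1} = {0..<int n}" using Suc by auto
  finally show ?thesis .
qed simp

lemma potential_shift:
  assumes "state n M"
  shows "potential n (\<lambda>q. M (q - 1) - 1) = potential n M"
proof -
  have "(\<Sum>p\<in>{0..<int n}. (M (p - 1) + (p - 1))\<^sup>2) = (\<Sum>p\<in>{0..<int n}. (M p + p)\<^sup>2)"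
    by (rule sum_shift_period[where g = "\<lambda>p. (M p + p)\<^sup>2"]) (use assms in \<open>simp add: state_def\<close>)
  then show ?thesis by (simp add: potential_def algebra_simps)
qed

text \<open>Only the mixed terms \<open>2 * p * M p\<close> change. The potential rises exactly when
  the larger level moves to the larger position.\<close>

lemma potential_tau:
  assumes n: "2 \<le> n" and M: "state n M"
  shows "int (potential n (M \<circ> tau n m)) = int (potential n M) + 2 * (M m - M (m + 1))"
proof -
  define h where "h p = (M (tau n m p) + p)\<^sup>2 - (M p + p)\<^sup>2" for p
  have per: "h p' = h p" if "int n dvd p' - p" for p p'
    using state_cong[OF M that] state_cong[OF state_tau[OF n M] that, of m] by (simp add: h_def)
  \<comment> \<open>The summation range contains exactly one translate of each of the two exchanged
    positions.\<close>
  define m0 m1 where "m0 = m mod int n" and "m1 = (m + 1) mod int n"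
  have m0: "m0 \<in> {0..<int n}" "int n dvd m0 - m" and m1: "m1 \<in> {0..<int n}" "int n dvd m1 - (m + 1)"
    using n by (auto simp: m0_def m1_def mod_eq_dvd_iff[symmetric])
  have ne: "m0 \<noteq> m1"
    using m0(2) m1(2) dvd_shift1(2)[OF n m0(2)] by (auto simp: algebra_simps)
  have z: "h p = 0" if "p \<in> {0..<int n} - {m0, m1}" for p
  proof -
    have "\<not> int n dvd p - m0" "\<not> int n dvd p - m1"
      using that m0(1) m1(1) by (auto simp: mod_eq_dvd_iff[symmetric])
    then have "\<not> int n dvd p - m" "\<not> int n dvd p - m - 1"
      using m0(2) m1(2) dvd_diff[of "int n" "p - m" "m0 - m"] dvd_diff[of "int n" "p - m - 1" "m1 - (m + 1)"]
      by auto
    then show ?thesis by (simp add: h_def tau_other)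
  qed
  have "(\<Sum>p\<in>{0..<int n}. h p) = (\<Sum>p\<in>{m0, m1}. h p)"
    by (rule sum.mono_neutral_right) (use m0 m1 z in auto)
  also have "\<dots> = h m + h (m + 1)" using ne per[OF m0(2)] per[OF m1(2)] by simp
  also have "\<dots> = 2 * (M m - M (m + 1))"
    unfolding h_def tau_simps(1) tau_simps(2)[OF n] by (simp add: power2_eq_square algebra_simps)
  finally have "(\<Sum>p\<in>{0..<int n}. (M (tau n m p) + p)\<^sup>2) = (\<Sum>p\<in>{0..<int n}. (M p + p)\<^sup>2) + 2 * (M m - M (m + 1))"
    by (simp add: h_def sum_subtractf)
  moreover have "int (potential n N) = (\<Sum>p\<in>{0..<int n}. (N p + p)\<^sup>2)" for N
    by (simp add: potential_def sum_nonneg)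
  ultimately show ?thesis by simp
qed


section \<open>Closed words, their rotation and their peaks\<close>

type_synonym aword = "(nat \<times> int) list"

fun final :: "nat \<Rightarrow> (int \<Rightarrow> int) \<Rightarrow> aword \<Rightarrow> int \<Rightarrow> int" where
  "final n M [] = M"
| "final n M ((a, m) # w) = final n (M \<circ> tau n m) w"

fun events :: "nat \<Rightarrow> (int \<Rightarrow> int) \<Rightarrow> aword \<Rightarrow> event list" where
  "events n M [] = []"
| "events n M ((a, m) # w) = (a, M m, M (m + 1)) # events n (M \<circ> tau n m) w"

text \<open>The initial potential is left out: in a closed word it equals the final one, so the list
  is the cyclic sequence without repetition.\<close>

fun potentials :: "nat \<Rightarrow> (int \<Rightarrow> int) \<Rightarrow> aword \<Rightarrow> nat list" where
  "potentials n M [] = []"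
| "potentials n M ((a, m) # w) = potential n (M \<circ> tau n m) # potentials n (M \<circ> tau n m) w"

text \<open>The virtual block of the braid is the shift by one position, which closes up a word in the torus;
  following a strand once around decreases its position and increases its level by one.\<close>

definition closed_word :: "nat \<Rightarrow> (int \<Rightarrow> int) \<Rightarrow> aword \<Rightarrow> bool" where
  "closed_word n M w \<longleftrightarrow> state n M \<and> (\<forall>q. final n M w q = M (q - 1) - 1) \<and> distinct (map fst w)"

lemma final_append [simp]: "final n M (u @ v) = final n (final n M u) v"
  by (induction n M u rule: final.induct) (auto simp: comp_def)

lemma events_append [simp]: "events n M (u @ v) = events n M u @ events n (final n M u) v"
  by (induction n M u rule: final.induct) (auto simp: comp_def)

lemma potentials_append [simp]: "potentials n M (u @ v) = potentials n M u @ potentials n (final n M u) v"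
  by (induction n M u rule: final.induct) (auto simp: comp_def)

lemma events_labels: "map fst (events n M w) = map fst w"
  by (induction n M w rule: final.induct) (auto simp: comp_def)

lemma length_potentials: "length (potentials n M w) = length w"
  by (induction n M w rule: final.induct) (auto simp: comp_def)

lemma state_final: "2 \<le> n \<Longrightarrow> state n M \<Longrightarrow> state n (final n M w)"
  by (induction n M w rule: final.induct) (use state_tau in \<open>auto simp: comp_def\<close>)

lemma final_potential:
  "potential n (final n M w) \<in> insert (potential n M) (set (potentials n M w))"
  by (induction n M w rule: final.induct) (auto simp: comp_def)

text \<open>The letter becomes \<open>m + 1\<close> because the final arrangement is the initial one
  moved up by one position.\<close>

lemma closed_word_rotate:
  assumes n: "2 \<le> n" and cl: "closed_word n M ((a, m) # w)"
  shows "closed_word n (M \<circ> tau n m) (w @ [(a, m + 1)])" (is ?A)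
    and "potentials n (M \<circ> tau n m) (w @ [(a, m + 1)]) = rotate1 (potentials n M ((a, m) # w))" (is ?B)
    and "req (code n layered (events n M ((a, m) # w)))
             (code n layered (events n (M \<circ> tau n m) (w @ [(a, m + 1)])))" (is ?C)
proof -
  have M: "state n M" and f: "final n (M \<circ> tau n m) w q = M (q - 1) - 1" for q
    using cl by (auto simp: closed_word_def)
  have f': "final n (M \<circ> tau n m) (w @ [(a, m + 1)]) = (\<lambda>q. (M \<circ> tau n m) (q - 1) - 1)"
    by (rule ext) (simp add: f tau_shift)
  show ?A using cl f' state_tau[OF n M] by (auto simp: closed_word_def)
  show ?B using f' potential_shift[OF state_tau[OF n M], of m] by simp
  have "m + 1 + 1 - 1 = m + 1" by simp
  then have "events n (M \<circ> tau n m) (w @ [(a, m + 1)]) = events n (M \<circ> tau n m) w @ [(a, M m - 1, M (m + 1) - 1)]"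
    unfolding events_append events.simps f by (simp add: add.commute)
  then show ?C using req_code_rotate[of n a "M m" "M (m + 1)"] n by simp
qed

lemma closed_word_rotate_iterated:
  assumes n: "2 \<le> n" and cl: "closed_word n M w"
  shows "\<exists>M' w'. closed_word n M' w' \<and> potentials n M' w' = rotate k (potentials n M w) \<and>
    req (code n layered (events n M w)) (code n layered (events n M' w'))"
proof (induction k)
  case 0
  show ?case using cl by (intro exI[of _ M] exI[of _ w]) simp
next
  case (Suc k)
  then obtain M' w' where 1: "closed_word n M' w'" "potentials n M' w' = rotate k (potentials n M w)"
    "req (code n layered (events n M w)) (code n layered (events n M' w'))" by blast
  show ?case
  proof (cases w')
    case Nil
    then have "rotate k (potentials n M w) = []" using 1(2) by simp
    then show ?thesis using 1 Nil by (intro exI[of _ M'] exI[of _ w']) simp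
  next
    case (Cons e v)
    obtain a m where e: "e = (a, m)" by fastforce
    note r = closed_word_rotate[OF n 1(1)[unfolded Cons e]]
    show ?thesis
      by (intro exI[of _ "M' \<circ> tau n m"] exI[of _ "v @ [(a, m + 1)]"] conjI r(1)
            req_trans[OF 1(3)[unfolded Cons e] r(3)])
        (simp only: r(2) 1(2)[unfolded Cons e] rotate_Suc)
  qed
qed

lemma mset_rotate: "mset (rotate k xs) = mset xs"
proof (induction k)
  case (Suc k)
  then show ?case by (cases "rotate k xs") (auto simp: rotate_Suc)
qed simp

text \<open>The word is cut so that a maximum of the potential stands just before its last letter.
  Neighbours are not higher, and no exchange preserves the potential, so both inequalities are
  strict.\<close>

lemma exists_peak:
  assumes n: "2 \<le> n" and cl: "closed_word n M w" and ne: "w \<noteq> []"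
  obtains M' u a m b m' where "closed_word n M' (u @ [(a, m), (b, m')])"
    "mset (potentials n M' (u @ [(a, m), (b, m')])) = mset (potentials n M w)"
    "req (code n layered (events n M w)) (code n layered (events n M' (u @ [(a, m), (b, m')])))"
    "final n M' (u @ [(a, m)]) m < final n M' (u @ [(a, m)]) (m + 1)"
    "final n M' (u @ [(a, m)]) m' < final n M' (u @ [(a, m)]) (m' + 1)"
proof -
  let ?P = "potentials n M w"
  have P: "?P \<noteq> []" using ne length_potentials[of n M w] by auto
  obtain i where i: "i < length ?P" "?P ! i = Max (set ?P)"
    using P by (metis List.finite_set Max_in in_set_conv_nth set_empty)
  \<comment> \<open>This rotation puts the maximum last; one further rotation below gives it a
    successor.\<close>
  obtain M1 w1 where 1: "closed_word n M1 w1" "potentials n M1 w1 = rotate (Suc i) ?P"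
    "req (code n layered (events n M w)) (code n layered (events n M1 w1))"
    using closed_word_rotate_iterated[OF n cl, of "Suc i"] by blast
  have len: "length w1 = length ?P" using 1(2) length_potentials[of n M1 w1] by simp
  have last: "last (potentials n M1 w1) = Max (set ?P)"
  proof -
    have "last (rotate (Suc i) ?P) = rotate (Suc i) ?P ! (length ?P - 1)"
      using P by (simp add: last_conv_nth del: rotate_Suc)
    also have "\<dots> = ?P ! ((Suc i + (length ?P - 1)) mod length ?P)"
      using P by (subst nth_rotate) auto
    also have "(Suc i + (length ?P - 1)) mod length ?P = i"
      using i P by simp
    finally show ?thesis using i 1(2) by simp
  qed
  have max: "x \<le> last (potentials n M1 w1)" if "x \<in> set (potentials n M1 w1)" for x
    using that last 1(2) by simp
  obtain b m' v where w1: "w1 = (b, m') # v" using len P by (cases w1) auto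
  have S1: "state n M1" and f1: "final n M1 w1 = (\<lambda>q. M1 (q - 1) - 1)"
    using 1(1) by (auto simp: closed_word_def)
  have pot1: "potential n (final n M1 w1) = potential n M1"
    unfolding f1 by (rule potential_shift[OF S1])
  have step: "potential n (N \<circ> tau n m) \<noteq> potential n N"
    "potential n (N \<circ> tau n m) \<le> potential n N \<Longrightarrow> N m < N (m + 1)" if "state n N" for N m
  proof -
    have "N m \<noteq> N (m + 1)" using that by (auto simp: state_def dest: injD)
    with potential_tau[OF n that, of m] show "potential n (N \<circ> tau n m) \<noteq> potential n N"
      "potential n (N \<circ> tau n m) \<le> potential n N \<Longrightarrow> N m < N (m + 1)"
      by auto
  qed
  \<comment> \<open>A single exchange changes the potential, whereas closing up preserves
    it.\<close>
  have "v \<noteq> []"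
  proof
    assume "v = []"
    then show False using pot1 step(1)[OF S1, of m'] w1 by simp
  qed
  then obtain u a m where v: "v = u @ [(a, m)]" by (metis rev_exhaust surj_pair)
  let ?M = "M1 \<circ> tau n m'" 
  let ?w = "u @ [(a, m), (b, m' + 1)]"
  let ?N = "final n ?M (u @ [(a, m)])"
  note r = closed_word_rotate[OF n 1(1)[unfolded w1]]
  have SN: "state n ?N" by (intro state_final n state_tau S1)
  have lastN: "last (potentials n M1 w1) = potential n ?N"
    unfolding w1 v by simp
  \<comment> \<open>Exchanges are involutions, so the predecessor of the peak is also reached from
    it by an exchange and both sides are treated alike.\<close>
  have N0: "?N \<circ> tau n m = final n ?M u"
    using n by (auto simp: fun_eq_iff)
  have "potential n (?N \<circ> tau n m) \<le> potential n ?N"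
    unfolding N0 lastN[symmetric] by (rule max) (use final_potential[of n ?M u] in \<open>auto simp: w1 v\<close>)
  then have lt1: "?N m < ?N (m + 1)" by (rule step(2)[OF SN])
  have "potential n (?N \<circ> tau n (m' + 1)) = potential n ?M"
  proof -
    have "?N \<circ> tau n (m' + 1) = final n ?M (v @ [(b, m' + 1)])" using v by simp
    also have "\<dots> = (\<lambda>q. ?M (q - 1) - 1)" using r(1) by (auto simp: closed_word_def)
    finally show ?thesis using potential_shift[OF state_tau[OF n S1]] by metis
  qed
  also have "\<dots> \<le> potential n ?N"
    unfolding lastN[symmetric] by (rule max) (simp add: w1)
  finally have lt2: "?N (m' + 1) < ?N (m' + 1 + 1)" by (rule step(2)[OF SN])
  have ww: "v @ [(b, m' + 1)] = ?w" by (simp add: v)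
  show thesis
  proof (rule that[of ?M u a m b "m' + 1"])
    show "closed_word n ?M ?w" using r(1) unfolding ww .
    show "mset (potentials n ?M ?w) = mset ?P"
      unfolding ww[symmetric] r(2) unfolding w1[symmetric] 1(2)
      by (simp only: mset_rotate flip: rotate_Suc)
    show "req (code n layered (events n M w)) (code n layered (events n ?M ?w))"
      using req_trans[OF 1(3)] r(3) unfolding ww w1 by blast
  qed (use lt1 lt2 in simp_all)
qed

section \<open>Peak reduction\<close>

lemma tau_add: "int n dvd d \<Longrightarrow> tau n m (q + d) = tau n m q + d"
proof -
  assume d: "int n dvd d"
  have "q + d - m = (q - m) + d" "q + d - m - 1 = (q - m - 1) + d" by simp_all
  then show ?thesis using d by (simp only: tau_def dvd_add_left_iff[OF d]) simp
qed

lemma tau_neighbours: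
  assumes "3 \<le> n"
  shows "tau n m (m + 2) = m + 2" "tau n (m + 1) m = m" "tau n (m + 1) (m + 2) = m + 1"
proof -
  have 1: "\<not> int n dvd 2" "\<not> int n dvd 1" "\<not> int n dvd -1" "\<not> int n dvd -2"
    using assms zdvd_not_zless[of 2 "int n"] by auto
  have "m - (m + 1) = -1" "m - (m + 1) - 1 = -2" "m + 2 - m = 2" "m + 2 - m - 1 = 1" "m + 2 - (m + 1) = 1" "m + 2 - (m + 1) - 1 = 0"
    by simp_all
  then show "tau n m (m + 2) = m + 2" "tau n (m + 1) m = m" "tau n (m + 1) (m + 2) = m + 1"
    unfolding tau_def using 1 by simp_all
qed

lemma tau_braid:
  assumes n: "3 \<le> n"
  shows "tau n m (tau n (m + 1) (tau n m q)) = tau n (m + 1) (tau n m (tau n (m + 1) q))"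
proof -
  have n2: "2 \<le> n" using n by simp
  have t: "tau n (m + 1) (m + 1) = m + 2" "tau n m m = m + 1" "tau n m (m + 1) = m"
    using tau_simps(1)[of n "m + 1"] n2 by simp_all
  consider "int n dvd q - m" | "int n dvd q - (m + 1)" | "int n dvd q - (m + 2)"
    | "\<not> int n dvd q - m" "\<not> int n dvd q - (m + 1)" "\<not> int n dvd q - (m + 2)"
    by blast
  then show ?thesis
  proof cases
    case 1
    define d where "d = q - m"
    have "q = m + d" "int n dvd d" using 1 by (simp_all add: d_def)
    then show ?thesis by (simp only: tau_add t tau_neighbours[OF n])
  next
    case 2
    define d where "d = q - (m + 1)"
    have "q = (m + 1) + d" "int n dvd d" using 2 by (simp_all add: d_def)
    then show ?thesis by (simp only: tau_add t tau_neighbours[OF n])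
  next
    case 3
    define d where "d = q - (m + 2)"
    have "q = (m + 2) + d" "int n dvd d" using 3 by (simp_all add: d_def)
    then show ?thesis by (simp only: tau_add t tau_neighbours[OF n])
  next
    case 4
    have "q - m - 1 = q - (m + 1)" "q - (m + 1) - 1 = q - (m + 2)" by simp_all
    then have "tau n m q = q" "tau n (m + 1) q = q" using 4 by (simp_all only: tau_def if_False)
    then show ?thesis by simp
  qed
qed

lemma tau_far:
  assumes "\<not> int n dvd m' - m" "\<not> int n dvd m' - m - 1" "\<not> int n dvd m' - m + 1"
  shows "tau n m m' = m'" "tau n m (m' + 1) = m' + 1" "tau n m' m = m" "tau n m' (m + 1) = m + 1"
proof -
  have "m - m' = - (m' - m)" "m - m' - 1 = - (m' - m + 1)" "m + 1 - m' = - (m' - m - 1)" "m + 1 - m' - 1 = - (m' - m)"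
    "m' + 1 - m = m' - m + 1" "m' + 1 - m - 1 = m' - m"
    by simp_all
  then show "tau n m m' = m'" "tau n m (m' + 1) = m' + 1" "tau n m' m = m" "tau n m' (m + 1) = m + 1"
    unfolding tau_def using assms by (simp_all only: dvd_minus_iff if_False)
qed

lemma tau_commute:
  assumes far: "\<not> int n dvd m' - m" "\<not> int n dvd m' - m - 1" "\<not> int n dvd m' - m + 1" and n: "2 \<le> n"
  shows "tau n m (tau n m' q) = tau n m' (tau n m q)"
proof -
  note t = tau_far[OF far] tau_simps(1) tau_simps(2)[OF n]
  consider "int n dvd q - m" | "int n dvd q - (m + 1)" | "int n dvd q - m'" | "int n dvd q - (m' + 1)"
    | "\<not> int n dvd q - m" "\<not> int n dvd q - m - 1" "\<not> int n dvd q - m'" "\<not> int n dvd q - m' - 1"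
    by (metis diff_diff_eq)
  then show ?thesis
  proof cases
    case 1
    define d where "d = q - m"
    have "q = m + d" "int n dvd d" using 1 by (simp_all add: d_def)
    then show ?thesis by (simp only: tau_add t)
  next
    case 2
    define d where "d = q - (m + 1)"
    have "q = (m + 1) + d" "int n dvd d" using 2 by (simp_all add: d_def)
    then show ?thesis by (simp only: tau_add t)
  next
    case 3
    define d where "d = q - m'"
    have "q = m' + d" "int n dvd d" using 3 by (simp_all add: d_def)
    then show ?thesis by (simp only: tau_add t)
  next
    case 4
    define d where "d = q - (m' + 1)"
    have "q = (m' + 1) + d" "int n dvd d" using 4 by (simp_all add: d_def)
    then show ?thesis by (simp only: tau_add t)
  next
    case 5
    then show ?thesis by (simp add: tau_other)
  qed
qed

lemma code_congI:
  assumes "\<And>r. r < n \<Longrightarrow> passage n ov E r = passage n ov' F r"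
  shows "code n ov E = code n ov' F"
  using assms by (auto simp: code_def intro!: arg_cong[of _ _ concat])

text \<open>Congruent letters exchange the same translates; both recorded levels move by the same
  multiple of \<open>n\<close>, which affects neither residues nor comparison. This reduces
  congruent letters to equal or adjacent ones.\<close>

lemma code_replace_last:
  assumes n: "2 \<le> n" and M: "state n M" and d: "int n dvd m' - m"
  shows "final n M (u @ [(b, m')]) = final n M (u @ [(b, m)])"
    "potentials n M (u @ [(b, m')]) = potentials n M (u @ [(b, m)])"
    "code n layered (events n M (u @ [(b, m')])) = code n layered (events n M (u @ [(b, m)]))"
    "closed_word n M (u @ [(b, m')]) = closed_word n M (u @ [(b, m)])"
proof -
  let ?N = "final n M u"
  have N: "state n ?N" by (rule state_final[OF n M])
  show f: "final n M (u @ [(b, m')]) = final n M (u @ [(b, m)])"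
    by (simp add: tau_cong[OF d])
  show "potentials n M (u @ [(b, m')]) = potentials n M (u @ [(b, m)])"
    by (simp add: tau_cong[OF d])
  show "closed_word n M (u @ [(b, m')]) = closed_word n M (u @ [(b, m)])"
    unfolding closed_word_def f by simp
  have d1: "int n dvd (m' + 1) - (m + 1)" using d by simp
  have e: "?N m' = ?N m - (m' - m)" "?N (m' + 1) = ?N (m + 1) - (m' - m)"
    using state_cong[OF N d] state_cong[OF N d1] by simp_all
  have r: "residue n (?N m') = residue n (?N m)" "residue n (?N (m' + 1)) = residue n (?N (m + 1))"
    using n d d1 by (simp_all add: state_residue[OF _ N])
  have "?N m' < ?N (m' + 1) \<longleftrightarrow> ?N m < ?N (m + 1)" using e by simp
  then show "code n layered (events n M (u @ [(b, m')])) = code n layered (events n M (u @ [(b, m)]))"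
    by (intro code_congI) (simp add: entries_def layered_def r)
qed

section \<open>Removing a peak: cancellation, commutation, hexagon\<close>

lemma fresh_labels:
  obtains c d :: nat where "c \<notin> set xs" "d \<notin> set xs" "c \<noteq> d"
proof -
  obtain c where c: "c \<notin> set xs" using ex_new_if_finite[OF infinite_UNIV_nat, of "set xs"] by auto
  obtain d where "d \<notin> set (c # xs)" using ex_new_if_finite[OF infinite_UNIV_nat, of "set (c # xs)"] by auto
  with c show thesis by (intro that[of c d]) auto
qed

definition reduces_to :: "nat \<Rightarrow> (int \<Rightarrow> int) \<Rightarrow> aword \<Rightarrow> aword \<Rightarrow> bool" where
  "reduces_to n M w w' \<longleftrightarrow> closed_word n M w' \<and>
    (mset (potentials n M w'), mset (potentials n M w)) \<in> mult less_than \<and>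
    req (code n layered (events n M w)) (code n layered (events n M w'))"

lemma mult_less_peak:
  assumes "\<forall>x \<in># A. x < y"
  shows "(I + A, add_mset (y :: nat) I) \<in> mult less_than"
  using one_step_implies_mult[of "{#y#}" A less_than I] assms by simp

lemma reduce_cancel:
  assumes n: "2 \<le> n" and cl: "closed_word n M (u @ [(a, m), (b, m)])"
    and pk: "final n M (u @ [(a, m)]) m < final n M (u @ [(a, m)]) (m + 1)"
  shows "reduces_to n M (u @ [(a, m), (b, m)]) u"
proof -
  let ?K = "final n M u"
  have M: "state n M" using cl by (simp add: closed_word_def)
  have K: "state n ?K" by (rule state_final[OF n M])
  have f: "final n M (u @ [(a, m), (b, m)]) = ?K" using n by (auto simp: fun_eq_iff)
  have cu: "closed_word n M u" using cl unfolding closed_word_def f by auto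
  have lt: "?K (m + 1) < ?K m" using pk n by simp
  have lab: "a \<notin> fst ` set (events n M u)" "b \<notin> fst ` set (events n M u)" "a \<noteq> b"
    using cl by (auto simp: closed_word_def events_labels simp flip: set_map)
  have "residue n (?K m) \<noteq> residue n (?K (m + 1))"
    using n state_residue[OF _ K, of m "m + 1"] by simp
  then have "req (code n layered (events n M u @ [(a, ?K m, ?K (m + 1)), (b, ?K (m + 1), ?K m)] @ []))
     (code n layered (events n M u @ []))"
    by (intro req_cancel_events) (use n lt lab in auto)
  moreover have "(mset (potentials n M u), mset (potentials n M (u @ [(a, m), (b, m)]))) \<in> mult less_than"
    using one_step_implies_mult[of "mset (potentials n (final n M u) [(a, m), (b, m)])" "{#}" less_than "mset (potentials n M u)"]
    by simp
  ultimately show ?thesis using cu n by (simp add: reduces_to_def)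
qed

text \<open>The two crossings involve disjoint pairs of passages, so the code stays literally the
  same; only the arrangement in the middle is replaced, by one lower than both of its
  neighbours.\<close>

lemma reduce_commute:
  assumes n: "2 \<le> n" and cl: "closed_word n M (u @ [(a, m), (b, m')])"
    and pk: "final n M (u @ [(a, m)]) m < final n M (u @ [(a, m)]) (m + 1)"
      "final n M (u @ [(a, m)]) m' < final n M (u @ [(a, m)]) (m' + 1)"
    and far: "\<not> int n dvd m' - m" "\<not> int n dvd m' - m - 1" "\<not> int n dvd m' - m + 1"
  shows "reduces_to n M (u @ [(a, m), (b, m')]) (u @ [(b, m'), (a, m)])"
proof -
  let ?K = "final n M u"
  have M: "state n M" using cl by (simp add: closed_word_def)
  have K: "state n ?K" by (rule state_final[OF n M])
  note t = tau_far[OF far]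
  have f: "?K \<circ> tau n m' \<circ> tau n m = ?K \<circ> tau n m \<circ> tau n m'"
    using tau_commute[OF far n] by (auto simp: fun_eq_iff)
  have cu: "closed_word n M (u @ [(b, m'), (a, m)])"
    using cl f by (auto simp: closed_word_def)
  have lt: "?K (m + 1) < ?K m" "?K m' < ?K (m' + 1)" using pk n t by simp_all
  have E1: "events n M (u @ [(a, m), (b, m')]) = events n M u @ [(a, ?K m, ?K (m + 1)), (b, ?K m', ?K (m' + 1))]"
    and E2: "events n M (u @ [(b, m'), (a, m)]) = events n M u @ [(b, ?K m', ?K (m' + 1)), (a, ?K m, ?K (m + 1))]"
    by (simp_all add: t)
  have ne: "residue n (?K p) \<noteq> residue n (?K q)" if "p \<in> {m, m + 1}" "q \<in> {m', m' + 1}" for p q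
  proof -
    have "m' - m = - (m - m')" "m' - m - 1 = - (m + 1 - m')" "m' - m + 1 = - (m - (m' + 1))" by simp_all
    then have "\<not> int n dvd m - m'" "\<not> int n dvd m + 1 - m'" "\<not> int n dvd m - (m' + 1)"
      using far by (metis dvd_minus_iff)+
    then show ?thesis using that n state_residue[OF _ K, of p q] by auto
  qed
  have "code n layered (events n M (u @ [(a, m), (b, m')])) = code n layered (events n M (u @ [(b, m'), (a, m)]))"
    unfolding E1 E2
    by (rule code_congI)
      (use ne[of m m'] ne[of m "m' + 1"] ne[of "m + 1" m'] ne[of "m + 1" "m' + 1"] in \<open>auto simp: entries_def\<close>)
  moreover have "potential n (?K \<circ> tau n m') < potential n (?K \<circ> tau n m)"
    using potential_tau[OF n K, of m] potential_tau[OF n K, of m'] lt by simp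
  then have "(mset (potentials n M (u @ [(b, m'), (a, m)])), mset (potentials n M (u @ [(a, m), (b, m')]))) \<in> mult less_than"
    using mult_less_peak[of "{#potential n (?K \<circ> tau n m')#}" "potential n (?K \<circ> tau n m)"
      "mset (potentials n M u) + {#potential n (?K \<circ> tau n m \<circ> tau n m')#}"]
    by (simp add: f)
  ultimately show ?thesis using cu by (simp add: reduces_to_def)
qed


text \<open>At a peak two adjacent inverting exchanges are rerouted below it: an R2 move adds the missing
  pair of crossings, and an R3 move reverses the resulting triangle.\<close>

lemma req_braid:
  assumes n: "3 \<le> n"
    and ord: "x < y" "y < z" and d: "distinct [residue n x, residue n y, residue n z]"
    and lab: "distinct [a, b, c, d]" "{a, b, c, d} \<inter> fst ` set E = {}"
  shows "req (code n layered (E @ [(a, y, x), (b, y, z)]))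
             (code n layered (E @ [(c, x, z), (b, y, z), (a, y, x), (d, z, x)]))" (is ?A)
    and "req (code n layered (E @ [(a, z, y), (b, x, y)]))
             (code n layered (E @ [(c, x, z), (b, x, y), (a, z, y), (d, z, x)]))" (is ?B)
proof -
  have "req (code n layered ((E @ [(a, y, x), (b, y, z)]) @ []))
            (code n layered ((E @ [(a, y, x), (b, y, z)]) @ [(c, x, z), (d, z, x)] @ []))"
    by (rule req_sym, rule req_cancel_events) (use n ord d lab in auto)
  also have "req \<dots> (code n layered (E @ [(c, x, z), (b, y, z), (a, y, x)] @ [(d, z, x)]))"
    using req_triangle[of n y x z a b c E "[(d, z, x)]"] n ord d lab by auto
  finally show ?A by simp
  have "req (code n layered ((E @ [(a, z, y), (b, x, y)]) @ []))
            (code n layered ((E @ [(a, z, y), (b, x, y)]) @ [(c, x, z), (d, z, x)] @ []))"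
    by (rule req_sym, rule req_cancel_events) (use n ord d lab in auto)
  also have "req \<dots> (code n layered (E @ [(c, x, z), (b, x, y), (a, z, y)] @ [(d, z, x)]))"
    using req_sym[OF req_triangle[of n x z y c b a E "[(d, z, x)]"]] n ord d lab by auto
  finally show ?B by simp
qed

text \<open>Three levels in three consecutive positions have six arrangements, forming a hexagon
  under adjacent exchanges with the ascending one highest. The path through the peak is replaced by
  the one through the three remaining vertices.\<close>

lemma reduce_braid:
  assumes n: "3 \<le> n" and cl: "closed_word n M (u @ [(a, m), (b, m')])"
    and pk: "final n M (u @ [(a, m)]) m < final n M (u @ [(a, m)]) (m + 1)"
      "final n M (u @ [(a, m)]) m' < final n M (u @ [(a, m)]) (m' + 1)"
    and adj: "m' = m + 1 \<or> m = m' + 1"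
  shows "\<exists>w'. reduces_to n M (u @ [(a, m), (b, m')]) w'"
proof -
  let ?K = "final n M u"
  let ?N = "?K \<circ> tau n m"
  have n2: "2 \<le> n" using n by simp
  have M: "state n M" using cl by (simp add: closed_word_def)
  have K: "state n ?K" by (rule state_final[OF n2 M])
  obtain c d where cd: "c \<notin> set (a # b # map fst u)" "d \<notin> set (a # b # map fst u)" "c \<noteq> d"
    by (rule fresh_labels)
  have lab: "distinct [a, b, c, d]" "{a, b, c, d} \<inter> fst ` set (events n M u) = {}"
    using cl cd by (auto simp: closed_word_def events_labels simp flip: set_map)
  \<comment> \<open>The braid relation solved for the product of the exchanges at \<open>m\<close>
    and \<open>m'\<close>; \<open>c\<close> and \<open>d\<close> label the crossings added by
    R2.\<close>
  let ?w = "u @ [(c, m'), (b, m), (a, m'), (d, m)]"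
  have braid: "tau n m (tau n m' (tau n m q)) = tau n m' (tau n m (tau n m' q))" for q
    using adj tau_braid[OF n] by auto
  have f: "?K \<circ> tau n m' \<circ> tau n m \<circ> tau n m' \<circ> tau n m = ?N \<circ> tau n m'"
    using n2 by (auto simp: fun_eq_iff simp flip: braid)
  have cw: "closed_word n M ?w"
    using cl f cd by (auto simp: closed_word_def)
  define k where "k = min m m'"
  define x y z where "x = ?N k" and "y = ?N (k + 1)" and "z = ?N (k + 2)"
  have xyz: "x < y" "y < z" using adj pk by (auto simp: x_def y_def z_def k_def min_def add.assoc)
  have N: "state n ?N" by (rule state_tau[OF n2 K])
  have d3: "distinct [residue n x, residue n y, residue n z]"
  proof -
    have "\<not> int n dvd 1" "\<not> int n dvd 2" using n zdvd_not_zless[of 2 "int n"] by auto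
    then have "\<not> int n dvd (k + 1) - k" "\<not> int n dvd (k + 2) - k" "\<not> int n dvd (k + 2) - (k + 1)" by simp_all
    then show ?thesis
      using n2 state_residue[OF _ N, of "k + 1" k] state_residue[OF _ N, of "k + 2" k] state_residue[OF _ N, of "k + 2" "k + 1"]
      by (auto simp: x_def y_def z_def)
  qed
  have t: "tau n k k = k + 1" "tau n k (k + 1) = k" "tau n k (k + 2) = k + 2"
      "tau n (k + 1) k = k" "tau n (k + 1) (k + 1) = k + 2" "tau n (k + 1) (k + 2) = k + 1"
    using tau_neighbours[OF n, of k] tau_simps(1)[of n "k + 1"] n2 by simp_all
  let ?K1 = "?K \<circ> tau n m'"
  let ?K2 = "?K1 \<circ> tau n m"
  let ?K3 = "?K2 \<circ> tau n m'"
  have S: "state n ?K1" "state n ?K2" "state n ?K3" by (intro state_tau n2 K)+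
  have main: "req (code n layered (events n M (u @ [(a, m), (b, m')]))) (code n layered (events n M ?w))
    \<and> potential n ?K1 < potential n ?N \<and> potential n ?K2 < potential n ?N \<and> potential n ?K3 < potential n ?N"
  proof (cases "m' = m + 1")
    case True
    then have m: "m = k" "m' = k + 1" by (simp_all add: k_def)
    have Kv: "?K k = y" "?K (k + 1) = x" "?K (k + 2) = z"
      unfolding x_def y_def z_def m using t by simp_all
    have "events n M (u @ [(a, m), (b, m')]) = events n M u @ [(a, y, x), (b, y, z)]"
      using Kv t unfolding m by (simp add: add.assoc)
    moreover have "events n M ?w = events n M u @ [(c, x, z), (b, y, z), (a, y, x), (d, z, x)]"
      using Kv t unfolding m by (simp add: add.assoc)
    moreover have "int (potential n ?N) = int (potential n ?K) + 2 * (y - x)"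
      "int (potential n ?K1) = int (potential n ?K) + 2 * (x - z)"
      "int (potential n ?K2) = int (potential n ?K1) + 2 * (y - z)"
      "int (potential n ?K3) = int (potential n ?K2) + 2 * (y - x)"
      using potential_tau[OF n2 K, of m] potential_tau[OF n2 K, of m'] potential_tau[OF n2 S(1), of m]
        potential_tau[OF n2 S(2), of m'] Kv t unfolding m by (simp_all add: add.assoc)
    ultimately show ?thesis using req_braid(1)[OF n xyz d3 lab] xyz by auto
  next
    case False
    then have m: "m' = k" "m = k + 1" using adj by (auto simp: k_def)
    have Kv: "?K k = x" "?K (k + 1) = z" "?K (k + 2) = y"
      unfolding x_def y_def z_def m using t by (simp_all add: add.commute)
    have "events n M (u @ [(a, m), (b, m')]) = events n M u @ [(a, z, y), (b, x, y)]"
      using Kv t unfolding m by (simp add: add.assoc)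
    moreover have "events n M ?w = events n M u @ [(c, x, z), (b, x, y), (a, z, y), (d, z, x)]"
      using Kv t unfolding m by (simp add: add.assoc)
    moreover have "int (potential n ?N) = int (potential n ?K) + 2 * (z - y)"
      "int (potential n ?K1) = int (potential n ?K) + 2 * (x - z)"
      "int (potential n ?K2) = int (potential n ?K1) + 2 * (x - y)"
      "int (potential n ?K3) = int (potential n ?K2) + 2 * (z - y)"
      using potential_tau[OF n2 K, of m] potential_tau[OF n2 K, of m'] potential_tau[OF n2 S(1), of m]
        potential_tau[OF n2 S(2), of m'] Kv t unfolding m by (simp_all add: add.assoc)
    ultimately show ?thesis using req_braid(2)[OF n xyz d3 lab] xyz by auto
  qed
  then have "(mset (potentials n M ?w), mset (potentials n M (u @ [(a, m), (b, m')]))) \<in> mult less_than"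
    using mult_less_peak[of "{#potential n ?K1, potential n ?K2, potential n ?K3#}" "potential n ?N"
      "mset (potentials n M u) + {#potential n (?N \<circ> tau n m')#}"]
    by (simp add: f add_mset_commute)
  then show ?thesis using cw main by (auto simp: reduces_to_def)
qed

lemma peak_reduces:
  assumes n: "2 \<le> n" and cl: "closed_word n M (u @ [(a, m), (b, m')])"
    and pk: "final n M (u @ [(a, m)]) m < final n M (u @ [(a, m)]) (m + 1)"
      "final n M (u @ [(a, m)]) m' < final n M (u @ [(a, m)]) (m' + 1)"
  shows "\<exists>w'. reduces_to n M (u @ [(a, m), (b, m')]) w'"
proof -
  let ?u = "u @ [(a, m)]"
  have M: "state n M" using cl by (simp add: closed_word_def)
  have N: "state n (final n M ?u)" by (rule state_final[OF n M])
  have repl: "\<exists>w'. reduces_to n M (u @ [(a, m), (b, m')]) w'"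
    if "int n dvd m' - k" "\<exists>w'. reduces_to n M (u @ [(a, m), (b, k)]) w'" for k
    using that(2) code_replace_last[OF n M that(1), of ?u b] by (simp add: reduces_to_def)
  have clk: "closed_word n M (u @ [(a, m), (b, k)])" if "int n dvd m' - k" for k
    using cl code_replace_last(4)[OF n M that, of ?u b] by simp
  have pkk: "final n M ?u k < final n M ?u (k + 1)" if "int n dvd m' - k" for k
    using pk(2) state_cong[OF N that] state_cong[OF N, of "m' + 1" "k + 1"] that by simp
  have adjacent: ?thesis if d: "int n dvd m' - k" and k: "k = m + 1 \<or> m = k + 1" for k
  proof (cases "n = 2")
    case True
    \<comment> \<open>With two strands, two adjacent ascending pairs would make the level grow over
      a full period, while it must drop by 2.\<close>
    have "final n M ?u (q + 2) = final n M ?u q - 2" for q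
      using N True by (simp add: state_def)
    from this[of m] this[of k] have False
      using pk(1) pkk[OF d] k by (auto simp: add.assoc)
    then show ?thesis ..
  next
    case False
    with n have "3 \<le> n" by simp
    from reduce_braid[OF this clk[OF d] pk(1) pkk[OF d] k] show ?thesis by (rule repl[OF d])
  qed
  consider "int n dvd m' - m" | "int n dvd m' - (m + 1)" | "int n dvd m' - (m - 1)"
    | "\<not> int n dvd m' - m" "\<not> int n dvd m' - m - 1" "\<not> int n dvd m' - m + 1"
    by (metis diff_diff_eq diff_diff_eq2 diff_add_eq)
  then show ?thesis
  proof cases
    case 1
    show ?thesis by (rule repl[OF 1]) (use reduce_cancel[OF n clk[OF 1] pk(1)] in blast)
  next
    case 2
    then show ?thesis by (rule adjacent) simp
  next
    case 3
    then show ?thesis by (rule adjacent) simp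
  next
    case 4
    from reduce_commute[OF n cl pk 4] show ?thesis by blast
  qed
qed

text \<open>Rotating to a peak keeps the multiset of potentials, so removing the peak lowers the
  measure of the original word as well.\<close>

theorem closed_word_trivial:
  assumes n: "2 \<le> n"
  shows "closed_word n M w \<Longrightarrow> req (code n layered (events n M w)) []"
proof (induction "mset (potentials n M w)" arbitrary: M w rule: wf_induct_rule[OF wf_mult[OF wf_less_than]])
  case 1
  show ?case
  proof (cases "w = []")
    case True
    moreover have "code n layered [] = []" by (simp add: code_def)
    ultimately show ?thesis by simp
  next
    case False
    from exists_peak[OF n 1(2) False] obtain M' u a m b m' where *:
      "closed_word n M' (u @ [(a, m), (b, m')])"
      "mset (potentials n M' (u @ [(a, m), (b, m')])) = mset (potentials n M w)"
      "req (code n layered (events n M w)) (code n layered (events n M' (u @ [(a, m), (b, m')])))"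
      "final n M' (u @ [(a, m)]) m < final n M' (u @ [(a, m)]) (m + 1)"
      "final n M' (u @ [(a, m)]) m' < final n M' (u @ [(a, m)]) (m' + 1)"
      by blast
    from peak_reduces[OF n *(1,4,5)] obtain w' where w': "reduces_to n M' (u @ [(a, m), (b, m')]) w'" ..
    then have "req (code n layered (events n M' w')) []"
      by (intro 1(1)) (auto simp: reduces_to_def *(2)[symmetric])
    with w' *(3) show ?thesis unfolding reduces_to_def by (meson req_trans)
  qed
qed

section \<open>The index of an event\<close>

abbreviation all_over :: "event \<Rightarrow> bool" where
  "all_over \<equiv> \<lambda>_. True"

lemma hsum_concat:
  "hsum a c (concat (map f [0..<n])) = (\<Sum>r<n. hsum a (c + (\<Sum>s<r. height (f s))) (f r))"
proof (induction n)
  case (Suc n)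
  have "height (concat (map f [0..<n])) = (\<Sum>s<n. height (f s))" for n
    by (induction n) auto
  with Suc show ?case by (simp add: hsum_append)
qed simp

text \<open>With all crossings positive, weights are steps of position, so the height of a passage
  is its displacement in the universal cover.\<close>

lemma height_passage:
  assumes n: "2 \<le> n"
  shows "state n M \<Longrightarrow> M p = int r \<Longrightarrow> r < n \<Longrightarrow>
    \<exists>q. final n M w q = int r \<and> height (passage n all_over (events n M w) r) = q - p"
proof (induction w arbitrary: M p)
  case Nil
  then show ?case by auto
next
  case (Cons e w)
  obtain a m where e: "e = (a, m)" by fastforce
  have r: "residue n (M p) = r" using Cons.prems by (simp add: residue_def)
  let ?p = "tau n m p"
  have "(M \<circ> tau n m) ?p = int r" using Cons.prems n by simp
  from Cons.IH[OF state_tau[OF n Cons.prems(1)] this Cons.prems(3)]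
  obtain q where q: "final n (M \<circ> tau n m) w q = int r"
    "height (passage n all_over (events n (M \<circ> tau n m) w) r) = q - ?p" by blast
  have 1: "residue n (M m) = r \<longleftrightarrow> int n dvd p - m" "residue n (M (m + 1)) = r \<longleftrightarrow> int n dvd p - m - 1"
    using state_residue[OF _ Cons.prems(1), of m p] state_residue[OF _ Cons.prems(1), of "m + 1" p] n r
      dvd_diff_commute[of "int n" m p] dvd_diff_commute[of "int n" "m + 1" p] by (simp_all add: diff_diff_eq)
  have "height (entries n all_over (a, M m, M (m + 1)) r) = ?p - p"
    using dvd_shift1(2)[OF n, of "p - m"] unfolding entries_def by (auto simp: 1 tau_def wt_def)
  then show ?case using q e by (intro exI[of _ q]) simp
qed

text \<open>Up to the constant \<open>P 0\<close>, the height reached along the knot is lifted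
  position plus level. The two branches meet the crossing at \<open>m\<close> and
  \<open>m + 1\<close>, so their heights differ by their levels once the crossing's own steps are
  accounted for.\<close>

lemma ind_event:
  assumes n: "2 \<le> n" and cl: "closed_word n M w" and P: "\<And>r. r < n \<Longrightarrow> M (P r) = int r"
    and e: "(a, x, y) \<in> set (events n M w)"
  shows "ind a (code n all_over (events n M w)) = 2 * (y - x)"
proof -
  have M: "state n M" using cl by (simp add: closed_word_def)
  have "a \<in> set (map fst w)" using e unfolding events_labels[of n M w, symmetric] by force
  then obtain m where "(a, m) \<in> set w" by auto
  then obtain u v where w: "w = u @ (a, m) # v" by (meson split_list)
  let ?N = "final n M u"
  let ?V = "events n (?N \<circ> tau n m) v"
  have fresh: "a \<notin> fst ` set (events n M u)" "a \<notin> fst ` set ?V"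
    using cl by (auto simp: closed_word_def w events_labels simp flip: set_map)
  have ev: "events n M w = events n M u @ (a, ?N m, ?N (m + 1)) # ?V" by (simp add: w)
  have xy: "x = ?N m" "y = ?N (m + 1)"
    using e fresh unfolding ev by (force simp: image_iff)+
  have N: "state n ?N" by (rule state_final[OF n M])
  let ?p = "passage n all_over (events n M w)"
  \<comment> \<open>The extra 1 is undone by the virtual block, which lowers the position by one and
    contributes no entry.\<close>
  have hp: "height (?p r) = P (Suc r) + 1 - P r" if r: "Suc r < n" for r
  proof -
    obtain q where q: "final n M w q = int r" "height (?p r) = q - P r"
      using height_passage[OF n M P[OF Suc_lessD[OF r]] Suc_lessD[OF r], of w] by blast
    have "M (q - 1) = M (P (Suc r))"
      using q(1) cl P[OF r] by (simp add: closed_word_def)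
    then have "q - 1 = P (Suc r)" using M by (simp add: state_def inj_eq)
    then show ?thesis using q(2) by simp
  qed
  have prefix: "(\<Sum>s<r. height (?p s)) = P r - P 0 + int r" if "r < n" for r
    using that by (induction r) (auto simp: hp)
  \<comment> \<open>The summands of \<open>hsum\<close>: an overpass of weight 1 at height
    \<open>x + m - P 0\<close>, and an underpass of weight -1 at height
    \<open>y + m + 1 - P 0\<close>.\<close>
  let ?x = "\<lambda>r. if residue n x = r then - (2 * (x + m - P 0) + 1) else 0"
  let ?y = "\<lambda>r. if residue n y = r then 2 * (y + m + 1 - P 0) - 1 else 0"
  have hs: "hsum a (0 + (\<Sum>s<r. height (?p s))) (?p r) = ?x r + ?y r" if r: "r < n" for r
  proof -
    obtain q where q: "?N q = int r" "height (passage n all_over (events n M u) r) = q - P r"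
      using height_passage[OF n M P[OF r] r, of u] by auto
    have l: "a \<notin> labels (passage n all_over (events n M u) r)" "a \<notin> labels (passage n all_over ?V r)"
      using fresh labels_passage by blast+
    have Nr: "residue n (?N q) = r" using q r by (simp add: residue_def)
    \<comment> \<open>Position plus level agrees on all translates of a strand.\<close>
    have x: "q + int r = x + m" if "residue n x = r"
      using that state_residue[OF _ N, of m q] state_cong[OF N, of m q] n Nr q(1) by (simp add: xy)
    have y: "q + int r = y + (m + 1)" if "residue n y = r"
      using that state_residue[OF _ N, of "m + 1" q] state_cong[OF N, of "m + 1" q] n Nr q(1) by (simp add: xy)
    have ne: "residue n x \<noteq> residue n y"
      using state_residue[OF _ N, of m "m + 1"] n by (simp add: xy)
    have "hsum a (0 + (\<Sum>s<r. height (?p s))) (?p r)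
        = hsum a (q - P 0 + int r) (entries n all_over (a, x, y) r)"
    proof -
      have "0 + (P r - P 0 + int r) + (q - P r) = q - P 0 + int r" by simp
      then show ?thesis
        unfolding prefix[OF r] unfolding ev passage_simps hsum_append q(2) xy
        by (simp add: hsum_fresh l algebra_simps)
    qed
    also have "\<dots> = ?x r + ?y r"
      using x y ne unfolding entries_def by (auto simp: osgn_def wt_def)
    finally show ?thesis .
  qed
  have "ind a (code n all_over (events n M w)) = (\<Sum>r<n. ?x r + ?y r)"
    unfolding code_def hsum_concat by (rule sum.cong) (use hs in auto)
  also have "\<dots> = 2 * (y - x)"
    using residue_less[of n] n by (simp add: sum.distrib)
  finally show ?thesis .
qed

lemma sum_list_code:
  fixes g :: "nat \<Rightarrow> int"
  assumes n: "0 < n"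
  shows "sum_list (map (\<lambda>e. g (fst e)) (code n ov E)) = 2 * sum_list (map (\<lambda>e. g (fst e)) E)"
proof -
  let ?G = "\<lambda>D. sum_list (map (\<lambda>e. g (fst e)) D)"
  have "?G (concat (map (passage n ov E) [0..<k])) = (\<Sum>r<k. ?G (passage n ov E r))" for k
    by (induction k) auto
  then have "?G (code n ov E) = (\<Sum>r<n. ?G (passage n ov E r))" by (simp add: code_def)
  also have "\<dots> = 2 * ?G E"
  proof (induction E)
    case (Cons e E)
    obtain a x y where e: "e = (a, x, y)" using prod_cases3 by blast
    have "(\<Sum>r<n. ?G (entries n ov e r)) =
        (\<Sum>r<n. (if residue n x = r then g a else 0) + (if residue n y = r then g a else 0))"
      by (rule sum.cong) (auto simp: entries_def e)
    also have "\<dots> = 2 * g a" using residue_less[OF n] by (simp add: sum.distrib)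
    finally show ?case using Cons e by (simp add: sum.distrib)
  qed simp
  finally show ?thesis .
qed

lemma jsum_code:
  assumes n: "2 \<le> n" and cl: "closed_word n M w" and P: "\<And>r. r < n \<Longrightarrow> M (P r) = int r"
  shows "jsum \<phi> (code n all_over (events n M w))
    = 2 * sum_list (map (\<lambda>(a, x, y). \<phi> (2 * (y - x))) (events n M w))"
proof -
  let ?D = "code n all_over (events n M w)"
  have "snd (snd e)" if "e \<in> set ?D" for e
    using that by (auto simp: code_def passage_def entries_def split: if_splits)
  then have "jsum \<phi> ?D = sum_list (map (\<lambda>e. \<phi> (ind (fst e) ?D)) ?D)"
    unfolding jsum_def by (intro arg_cong[of _ _ sum_list] map_cong) auto
  also have "\<dots> = 2 * sum_list (map (\<lambda>e. \<phi> (ind (fst e) ?D)) (events n M w))"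
    by (rule sum_list_code) (use n in simp)
  also have "map (\<lambda>e. \<phi> (ind (fst e) ?D)) (events n M w) = map (\<lambda>(a, x, y). \<phi> (2 * (y - x))) (events n M w)"
    by (rule map_cong) (auto simp: ind_event[OF n cl P])
  finally show ?thesis .
qed

section \<open>Counting crossing changes\<close>

lemma cc_code: "cc a (code n ov E) = code n (\<lambda>e. if fst e = a then \<not> ov e else ov e) E"
proof -
  have 1: "map (flip_at a) (entries n ov e r) = entries n (\<lambda>e. if fst e = a then \<not> ov e else ov e) e r" for e r
    by (cases e) (auto simp: entries_def flip_at_def)
  have 2: "map (flip_at a) (passage n ov E r) = passage n (\<lambda>e. if fst e = a then \<not> ov e else ov e) E r" for r
    by (induction E) (auto simp: 1)
  show ?thesis unfolding cc_eq_map code_def by (simp add: map_concat comp_def 2)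
qed

lemma labels_code_eq:
  assumes "0 < n"
  shows "labels (code n ov E) = fst ` set E"
proof
  show "fst ` set E \<subseteq> labels (code n ov E)"
  proof
    fix a assume "a \<in> fst ` set E"
    then obtain x y where e: "(a, x, y) \<in> set E" by force
    then have "a \<in> labels (passage n ov E (residue n x))"
      by (force simp: passage_def entries_def labels_def)
    then show "a \<in> labels (code n ov E)"
      using residue_less[OF assms, of x] by (auto simp: code_def labels_def) force
  qed
qed (rule labels_code)

lemma unk_code_changes:
  assumes "0 < n"
  shows "distinct as \<Longrightarrow> set as \<subseteq> fst ` set E \<Longrightarrow>
    unk (code n (\<lambda>e. if fst e \<in> set as then \<not> ov e else ov e) E) m \<Longrightarrow> unk (code n ov E) (length as + m)"
proof (induction as arbitrary: ov)
  case (Cons a as)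
  let ?ov = "\<lambda>e. if fst e = a then \<not> ov e else ov e"
  have "(\<lambda>e. if fst e \<in> set as then \<not> ?ov e else ?ov e) = (\<lambda>e. if fst e \<in> set (a # as) then \<not> ov e else ov e)"
    using Cons.prems(1) by auto
  then have "unk (code n ?ov E) (length as + m)"
    using Cons.IH[of ?ov] Cons.prems by simp
  then have "unk (cc a (code n ov E)) (length as + m)" by (simp add: cc_code)
  then show ?case
    using unk.change[of a "code n ov E"] Cons.prems(2) labels_code_eq[OF assms, of ov E] by simp
qed simp

lemma events_levels_neq:
  assumes n: "2 \<le> n"
  shows "state n M \<Longrightarrow> (a, x, y) \<in> set (events n M w) \<Longrightarrow> x \<noteq> y"
proof (induction w arbitrary: M)
  case (Cons e w)
  obtain b m where e: "e = (b, m)" by fastforce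
  have "M m \<noteq> M (m + 1)" using Cons.prems(1) by (simp add: state_def inj_eq)
  then show ?case using Cons.IH[OF state_tau[OF n Cons.prems(1)]] Cons.prems(2) by (auto simp: e comp_def)
qed simp

theorem vu_closed_word:
  assumes n: "2 \<le> n" and cl: "closed_word n M w" and P: "\<And>r. r < n \<Longrightarrow> M (P r) = int r"
  defines "D \<equiv> code n all_over (events n M w)"
  shows "virtually_null_homotopic D" "2 * vu D = length w"
proof -
  let ?E = "events n M w"
  define as where "as = map fst (filter (\<lambda>e. \<not> layered e) ?E)"
  have dist: "distinct (map fst ?E)" using cl by (simp add: closed_word_def events_labels)
  have "code n (\<lambda>e. fst e \<notin> set as) ?E = code n layered ?E"
  proof -
    have *: "(fst e \<notin> set as) = layered e" if "e \<in> set ?E" for e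
      using that dist by (auto simp: as_def distinct_map inj_on_def)
    have "entries n (\<lambda>e. fst e \<notin> set as) e r = entries n layered e r" if "e \<in> set ?E" for e r
      using *[OF that] by (cases e) (simp add: entries_def)
    then have "map (\<lambda>e. entries n (\<lambda>e. fst e \<notin> set as) e r) ?E = map (\<lambda>e. entries n layered e r) ?E" for r
      by (intro map_cong refl)
    then show ?thesis by (intro code_congI) (simp only: passage_def)
  qed
  moreover have "unk (code n layered ?E) 0"
    using unk_req[OF closed_word_trivial[OF n cl] unk.triv] .
  ultimately have "unk (code n (\<lambda>e. fst e \<notin> set as) ?E) 0" by simp
  have unk: "unk D (length as)"
  proof -
    have "(\<lambda>e. if fst e \<in> set as then \<not> all_over e else all_over e) = (\<lambda>e. fst e \<notin> set as)"
      by auto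
    moreover have "distinct as" "set as \<subseteq> fst ` set ?E"
      using dist by (auto simp: as_def distinct_map_filter)
    ultimately show ?thesis
      using unk_code_changes[of n as ?E all_over 0] n \<open>unk (code n (\<lambda>e. fst e \<notin> set as) ?E) 0\<close>
      by (simp add: D_def)
  qed
  from unk show "virtually_null_homotopic D" by (auto simp: virtually_null_homotopic_def)
  have M: "state n M" using cl by (simp add: closed_word_def)
  have ne: "x \<noteq> y" if "(a, x, y) \<in> set ?E" for a x y
    using events_levels_neq[OF n M that] .
  \<comment> \<open>All crossings are positive, so this says that as many events have
    \<open>x < y\<close> as \<open>x > y\<close>; the latter are the changed ones.\<close>
  have "sum_list (map (\<lambda>(a, x, y). sgn (2 * (y - x))) ?E) = 0"
    using unk_invariants[OF unk] jsum_code[OF n cl P, of sgn] by (simp add: D_def)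
  moreover have "sum_list (map (\<lambda>(a, x, y). sgn (2 * (y - x))) E) = int (length E) - 2 * int (length (filter (\<lambda>e. \<not> layered e) E))"
    if "\<And>a x y. (a, x, y) \<in> set E \<Longrightarrow> x \<noteq> y" for E
    using that
  proof (induction E)
    case (Cons e E)
    obtain a x y where e: "e = (a, x, y)" using prod_cases3 by blast
    have "x \<noteq> y" using Cons.prems[of a x y] e by simp
    moreover have "sum_list (map (\<lambda>(a, x, y). sgn (2 * (y - x))) E)
        = int (length E) - 2 * int (length (filter (\<lambda>e. \<not> layered e) E))"
      by (rule Cons.IH) (use Cons.prems in auto)
    ultimately show ?case by (cases "x < y") (simp_all add: e layered_def sgn_mult)
  qed simp
  ultimately have "int (length ?E) = 2 * int (length as)"
    using ne by (simp add: as_def)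
  moreover have "length ?E = length w" by (metis events_labels length_map)
  ultimately have len: "length w = 2 * length as" by simp
  have "length as \<le> m" if "unk D m" for m
  proof -
    \<comment> \<open>No index vanishes, so every crossing counts in the lower bound.\<close>
    have "map (\<lambda>(a, x, y). of_bool (2 * (y - x) \<noteq> 0) :: int) ?E = map (\<lambda>_. 1) ?E"
      by (rule map_cong) (auto dest: ne)
    then have "sum_list (map (\<lambda>(a, x, y). of_bool (2 * (y - x) \<noteq> 0) :: int) ?E) = int (length ?E)"
      by (simp only: sum_list_triv)
    then have "jsum (\<lambda>x. of_bool (x \<noteq> 0)) D = 2 * int (length ?E)"
      using jsum_code[OF n cl P, of "\<lambda>x. of_bool (x \<noteq> 0)"] by (simp add: D_def)
    then show ?thesis
      using unk_invariants[OF that] \<open>length ?E = length w\<close> len by simp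
  qed
  then have "vu D = length as"
    unfolding vu_def by (intro Least_equality unk)
  then show "2 * vu D = length w" using len by simp
qed

section \<open>The closed virtual braid\<close>

lemma pass_append:
  "pass (v @ w) t p = (let (e, q) = pass v t p; (r, q') = pass w (t + length v) q in (e @ r, q'))"
  by (induction v t p rule: pass.induct) (auto simp: Let_def split: prod.splits)

lemma pass_virtual:
  assumes "1 \<le> n" "1 \<le> p"
  shows "pass (map Vi [1..<n]) t p = ([], if p = 1 then n else if p \<le> n then p - 1 else p)"
  using assms(1)
proof (induction n rule: dec_induct)
  case (step n)
  have "[1..<Suc n] = [1..<n] @ [n]" using step by simp
  then show ?case using step assms(2) by (auto simp: pass_append)
qed (use assms in simp)

lemma trace_eq_concat: "trace w n p = concat (map (\<lambda>r. fst (pass w 0 ((braid_perm w ^^ r) p))) [0..<n])"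
proof (induction n arbitrary: p)
  case (Suc n)
  have "[0..<Suc n] = 0 # map Suc [0..<n]" by (simp add: map_Suc_upt upt_conv_Cons)
  then show ?case by (simp add: Suc.IH comp_def funpow_swap1 del: upt_Suc flip: braid_perm_def)
qed simp

fun labelled :: "nat \<Rightarrow> nat list \<Rightarrow> aword" where
  "labelled t [] = []"
| "labelled t (m # ms) = (t, int m) # labelled (Suc t) ms"

lemma length_labelled: "length (labelled t ms) = length ms"
  by (induction t ms rule: labelled.induct) auto

lemma map_fst_labelled: "map fst (labelled t ms) = [t..<t + length ms]"
  by (induction t ms rule: labelled.induct) (auto simp: upt_conv_Cons simp del: upt_Suc)

lemma pass_classical:
  assumes n: "2 \<le> n"
  shows "state n M \<Longrightarrow> \<forall>m \<in> set ms. 1 \<le> m \<and> m < n \<Longrightarrow> 1 \<le> p \<Longrightarrow> p \<le> n \<Longrightarrow>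
    fst (pass (map Cl ms) t p) = passage n all_over (events n M (labelled t ms)) (residue n (M (int p)))
    \<and> final n M (labelled t ms) (int (snd (pass (map Cl ms) t p))) = M (int p)
    \<and> 1 \<le> snd (pass (map Cl ms) t p) \<and> snd (pass (map Cl ms) t p) \<le> n"
proof (induction ms arbitrary: M t p)
  case (Cons m ms)
  define q where "q = (if p = m then Suc m else if p = Suc m then m else p)"
  have m: "1 \<le> m" "m < n" and q: "1 \<le> q" "q \<le> n" using Cons.prems by (auto simp: q_def)
  \<comment> \<open>Within one period congruence is equality, so the periodic exchange acts there as
    the transposition of the braid.\<close>
  have small: "int n dvd int k - int l \<longleftrightarrow> k = l" if "1 \<le> k" "k \<le> n" "1 \<le> l" "l \<le> n" for k l :: nat
  proof -
    have "k = l" if "int n dvd int k - int l"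
      using zdvd_imp_le[OF that] zdvd_imp_le[of "int n" "int l - int k"] that \<open>1 \<le> k\<close> \<open>k \<le> n\<close> \<open>1 \<le> l\<close> \<open>l \<le> n\<close>
      by (cases "k < l"; cases "l < k") (auto simp: dvd_diff_commute)
    then show ?thesis by auto
  qed
  have s: "int n dvd int p - int m \<longleftrightarrow> p = m" "int n dvd int p - int m - 1 \<longleftrightarrow> p = Suc m"
    using small[of p m] small[of p "Suc m"] Cons.prems m by (simp_all add: diff_diff_eq add.commute)
  have tq: "tau n (int m) (int q) = int p"
  proof -
    have "tau n (int m) (int p) = int q" using s by (auto simp: tau_def q_def)
    then show ?thesis using n tau_tau by metis
  qed
  have r: "residue n (M (int m)) = residue n (M (int p)) \<longleftrightarrow> p = m"
    "residue n (M (int m + 1)) = residue n (M (int p)) \<longleftrightarrow> p = Suc m"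
    using s n state_residue[OF _ Cons.prems(1), of "int m" "int p"] state_residue[OF _ Cons.prems(1), of "int m + 1" "int p"]
      dvd_diff_commute[of "int n" "int m" "int p"] dvd_diff_commute[of "int n" "int m + 1" "int p"]
    by (simp_all add: diff_diff_eq add.commute)
  have en: "entries n all_over (t, M (int m), M (int m + 1)) (residue n (M (int p)))
      = (if p = m then [(t, True, True)] else if p = Suc m then [(t, False, True)] else [])"
    unfolding entries_def by (simp add: r)
  have ps: "pass (map Cl (m # ms)) t p = (let (e, q') = pass (map Cl ms) (Suc t) q in
      ((if p = m then [(t, True, True)] else if p = Suc m then [(t, False, True)] else []) @ e, q'))"
    by (simp add: q_def)
  show ?case
    using Cons.IH[OF state_tau[OF n Cons.prems(1), of "int m"] _ q, of "Suc t"] Cons.prems(2)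
    unfolding ps by (auto simp: tq en comp_def split: prod.splits)
qed simp

text \<open>A return to 1 before time \<open>n\<close> would leave the orbit too small to cover all
  \<open>n\<close> positions; hence the first \<open>n\<close> iterates are distinct, and the next
  one can only be 1.\<close>

lemma full_orbit:
  fixes f :: "nat \<Rightarrow> nat"
  assumes maps: "f ` {1..n} \<subseteq> {1..n}" and inj: "inj_on f {1..n}" and n: "1 \<le> n"
    and orbit: "\<forall>p\<in>{1..n}. \<exists>k. (f ^^ k) 1 = p"
  shows "bij_betw (\<lambda>r. (f ^^ r) 1) {..<n} {1..n}" "(f ^^ n) 1 = 1"
proof -
  have mem: "(f ^^ r) 1 \<in> {1..n}" for r
  proof (induction r)
    case (Suc r)
    then have "f ((f ^^ r) 1) \<in> f ` {1..n}" by (rule imageI)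
    with maps show ?case by auto
  qed (use n in simp)
  have cancel: "(f ^^ d) 1 = 1" if "(f ^^ (r + d)) 1 = (f ^^ r) 1" for r d
    using that
  proof (induction r)
    case (Suc r)
    then have "f ((f ^^ (r + d)) 1) = f ((f ^^ r) 1)" by simp
    then show ?case using Suc.IH inj_onD[OF inj] mem by blast
  qed simp
  have large: "n \<le> d" if d: "(f ^^ d) 1 = 1" "0 < d" for d
  proof -
    have "(f ^^ k) 1 = (f ^^ (k mod d)) 1" for k
      using funpow_mod_eq[OF d(1)] by simp
    then have "(f ^^ k) 1 \<in> (\<lambda>r. (f ^^ r) 1) ` {..<d}" for k
      using d(2) by (intro image_eqI[of _ _ "k mod d"]) auto
    then have "{1..n} \<subseteq> (\<lambda>r. (f ^^ r) 1) ` {..<d}"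
      using orbit by fastforce
    then have "card {1..n} \<le> card {..<d}"
      by (meson card_image_le card_mono finite_imageI finite_lessThan order_trans)
    then show ?thesis by simp
  qed
  have "inj_on (\<lambda>r. (f ^^ r) 1) {..<n}"
  proof (rule linorder_inj_onI')
    fix r s assume rs: "r \<in> {..<n}" "s \<in> {..<n}" "r < s"
    then show "(f ^^ r) 1 \<noteq> (f ^^ s) 1"
      using cancel[of r "s - r"] large[of "s - r"] by fastforce
  qed
  then show bij: "bij_betw (\<lambda>r. (f ^^ r) 1) {..<n} {1..n}"
    using mem by (intro bij_betw_imageI card_subset_eq) (auto simp: card_image)
  obtain r where r: "r < n" "(f ^^ n) 1 = (f ^^ r) 1"
    using mem[of n] bij unfolding bij_betw_def by blast
  then have "(f ^^ (n - r)) 1 = 1" using cancel[of r "n - r"] by simp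
  then have "n \<le> n - r" using r large by simp
  with r n show "(f ^^ n) 1 = 1" by (cases r) auto
qed

lemma state_exists:
  assumes bij: "bij_betw pos {..<n} {1..n}" and n: "1 \<le> n"
  obtains M where "state n M" "\<And>r. r < n \<Longrightarrow> M (int (pos r)) = int r"
proof -
  define idx where "idx = the_inv_into {..<n} pos"
  have idx: "idx (pos r) = r" if "r < n" for r
    using that bij by (auto simp: idx_def bij_betw_def the_inv_into_f_f)
  have idx_less: "idx p < n" "pos (idx p) = p" if "1 \<le> p" "p \<le> n" for p
  proof -
    have "p \<in> pos ` {..<n}" using that bij by (simp add: bij_betw_def)
    then obtain r where "r < n" "p = pos r" by auto
    then show "idx p < n" "pos (idx p) = p" using idx by auto
  qed
  \<comment> \<open>Positions \<open>1..n\<close> serve as the fundamental period, hence the offset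
    1; elsewhere the slope of a state dictates the value.\<close>
  define M where "M q = int (idx (nat ((q - 1) mod int n) + 1)) - int n * ((q - 1) div int n)" for q
  have "M (q + int n) = M q - int n" for q
  proof -
    have e: "q + int n - 1 = (q - 1) + int n" by simp
    show ?thesis unfolding M_def e using n by (simp add: distrib_left)
  qed
  moreover have "inj M"
  proof (rule injI)
    fix q q' assume eq: "M q = M q'"
    have red: "idx (nat ((q - 1) mod int n) + 1) < n" "pos (idx (nat ((q - 1) mod int n) + 1)) = nat ((q - 1) mod int n) + 1" for q
    proof -
      have "0 \<le> (q - 1) mod int n" "(q - 1) mod int n < int n" using n by simp_all
      then have "nat ((q - 1) mod int n) + 1 \<le> n" by linarith
      then show "idx (nat ((q - 1) mod int n) + 1) < n" "pos (idx (nat ((q - 1) mod int n) + 1)) = nat ((q - 1) mod int n) + 1"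
        using idx_less by simp_all
    qed
    have Mmod: "M q mod int n = int (idx (nat ((q - 1) mod int n) + 1))" for q
    proof -
      have "M q = int (idx (nat ((q - 1) mod int n) + 1)) + int n * (- ((q - 1) div int n))"
        by (simp add: M_def)
      then show ?thesis using red(1)[of q] by (simp only: mod_mult_self2) simp
    qed
    have i: "idx (nat ((q - 1) mod int n) + 1) = idx (nat ((q' - 1) mod int n) + 1)"
      using Mmod[of q] Mmod[of q'] eq by simp
    then have "nat ((q - 1) mod int n) = nat ((q' - 1) mod int n)"
      using red(2)[of q] red(2)[of q'] by simp
    then have "(q - 1) mod int n = (q' - 1) mod int n"
      using n by (simp add: eq_nat_nat_iff)
    moreover have "(q - 1) div int n = (q' - 1) div int n"
      using eq i n by (simp add: M_def)
    ultimately have "q - 1 = q' - 1" by (metis mult_div_mod_eq)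
    then show "q = q'" by simp
  qed
  ultimately have "state n M" by (simp add: state_def)
  moreover have "M (int (pos r)) = int r" if "r < n" for r
  proof -
    have "1 \<le> pos r" "pos r \<le> n" using that bij by (auto simp: bij_betw_def)
    then have "(int (pos r) - 1) mod int n = int (pos r) - 1" "(int (pos r) - 1) div int n = 0" by simp_all
    moreover have "nat (int (pos r) - 1) + 1 = pos r" using \<open>1 \<le> pos r\<close> by simp
    ultimately show ?thesis using idx[OF that] by (simp add: M_def)
  qed
  ultimately show thesis by (rule that)
qed

definition classical_part :: "nat \<Rightarrow> nat \<Rightarrow> nat \<Rightarrow> nat list" where
  "classical_part i j k = concat (replicate (j - 1) [1..<i]) @ rev [1..<Suc k]"

lemma braid_word_eq: "braid_word i j k = map Vi [1..<i] @ map Cl (classical_part i j k)"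
  by (simp add: braid_word_def classical_part_def map_concat)

lemma length_classical_part: "length (classical_part i j k) = (i - 1) * (j - 1) + k"
  by (simp add: classical_part_def length_concat sum_list_replicate)

lemma diagram_closed_word:
  assumes n: "2 \<le> n" and k: "k < n" and one: "one_component n j k"
  obtains M P w where "closed_word n M w" "\<forall>r<n. M (P r) = int r"
    "diagram n j k = code n all_over (events n M w)" "length w = (n - 1) * (j - 1) + k"
proof -
  let ?W = "braid_word n j k"
  define ms where "ms = classical_part n j k"
  define f where "f = braid_perm ?W"
  \<comment> \<open>Action of the virtual block. Levels are assigned after it, so passage
    \<open>r\<close> enters the classical part at \<open>V (orb_pos r)\<close>.\<close>
  define V where "V p = (if p = 1 then n else p - 1)" for p
  \<comment> \<open>Labels are places in the whole braid word, and the virtual block occupies the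
    first \<open>n - 1\<close> of them.\<close>
  let ?w = "labelled (n - 1) ms"
  have ms: "\<forall>m \<in> set ms. 1 \<le> m \<and> m < n"
    using k by (auto simp: ms_def classical_part_def)
  have V: "V p \<in> {1..n}" if "p \<in> {1..n}" for p using that n by (auto simp: V_def)
  have Vinj: "inj_on V {1..n}" by (auto simp: inj_on_def V_def split: if_splits)
  have pass: "pass ?W 0 p = pass (map Cl ms) (n - 1) (V p)" if "p \<in> {1..n}" for p
  proof -
    have "pass (map Vi [1..<n]) 0 p = ([], V p)"
      using pass_virtual[of n p 0] that n by (auto simp: V_def)
    then show ?thesis
      unfolding braid_word_eq ms_def[symmetric] pass_append by (simp add: case_prod_beta)
  qed
  have f: "f p = snd (pass (map Cl ms) (n - 1) (V p))" if "p \<in> {1..n}" for p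
    using pass[OF that] by (simp add: f_def braid_perm_def)
  have pc: "fst (pass ?W 0 p) = passage n all_over (events n M ?w) (residue n (M (int (V p))))"
    "final n M ?w (int (f p)) = M (int (V p))" "f p \<in> {1..n}"
    if "state n M" "p \<in> {1..n}" for M p
    using pass_classical[OF n that(1) ms, of "V p" "n - 1"] V[OF that(2)] f[OF that(2)] pass[OF that(2)] by auto
  \<comment> \<open>Any state would do: it only serves to extract injectivity of the braid
    permutation before the intended state exists.\<close>
  have S0: "state n uminus" by (auto simp: state_def inj_def)
  have finj: "inj_on f {1..n}"
  proof (rule inj_onI)
    fix p q assume *: "p \<in> {1..n}" "q \<in> {1..n}" "f p = f q"
    then have "int (V p) = int (V q)" using pc(2)[OF S0 *(1)] pc(2)[OF S0 *(2)] by simp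
    then show "p = q" using inj_onD[OF Vinj] * by simp
  qed
  have fmaps: "f ` {1..n} \<subseteq> {1..n}" using pc(3)[OF S0] by blast
  have "1 \<le> n" using n by simp
  note orb = full_orbit[OF fmaps finj this one[unfolded one_component_def f_def[symmetric]]]
  define orb_pos where "orb_pos r = (f ^^ r) 1" for r
  have Vbij: "bij_betw V {1..n} {1..n}"
    using V Vinj by (intro bij_betw_imageI endo_inj_surj) auto
  have pbij: "bij_betw (\<lambda>r. V (orb_pos r)) {..<n} {1..n}"
    using bij_betw_trans[OF orb(1) Vbij] by (simp add: comp_def orb_pos_def)
  obtain M where M: "state n M" and MP: "\<And>r. r < n \<Longrightarrow> M (int (V (orb_pos r))) = int r"
    using state_exists[OF pbij \<open>1 \<le> n\<close>] by blast
  have orb_mem: "orb_pos r \<in> {1..n}" if "r < n" for r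
    using that orb(1) by (auto simp: bij_betw_def orb_pos_def)
  have orb_1: "orb_pos r \<noteq> 1" if "0 < r" "r < n" for r
    using that orb(1) inj_onD[of orb_pos "{..<n}" r 0] by (auto simp: bij_betw_def orb_pos_def[abs_def])
  have base: "final n M ?w (int (f (orb_pos r))) = M (int (f (orb_pos r)) - 1) - 1" if r: "r < n" for r
  proof -
    have l: "final n M ?w (int (f (orb_pos r))) = int r"
      using pc(2)[OF M orb_mem[OF r]] MP[OF r] by simp
    have fs: "f (orb_pos r) = orb_pos (Suc r)" by (simp add: orb_pos_def)
    show ?thesis
    proof (cases "Suc r = n")
      case True
      \<comment> \<open>Passage 0 leaves the virtual block in position \<open>n\<close> with level
        0; its translate in position 0 has level \<open>n\<close>, one more than the last passage,
        which ends in position 1.\<close>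
      have "M (int n) = 0" using MP[of 0] n by (simp add: orb_pos_def V_def)
      then have "M 0 = int n" using M by (metis add_0 diff_eq_eq state_def)
      moreover have "orb_pos (Suc r) = 1" unfolding orb_pos_def True by (rule orb(2))
      ultimately show ?thesis using l True unfolding fs by simp
    next
      case False
      then have "Suc r < n" using r by simp
      then have "M (int (orb_pos (Suc r) - 1)) = int (Suc r)" "1 \<le> orb_pos (Suc r)"
        using MP[of "Suc r"] orb_1[of "Suc r"] orb_mem[of "Suc r"] by (auto simp: V_def)
      then show ?thesis using l unfolding fs by (simp add: of_nat_diff)
    qed
  qed
  have closed: "final n M ?w q = M (q - 1) - 1" for q
  proof -
    \<comment> \<open>The representative of \<open>q\<close> in \<open>1..n\<close>, where
      \<open>base\<close> applies; periodicity does the rest.\<close>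
    define p where "p = nat ((q - 1) mod int n) + 1"
    have b: "0 \<le> (q - 1) mod int n" "(q - 1) mod int n < int n" using n by simp_all
    then have p: "p \<in> {1..n}" by (auto simp: p_def)
    have dv: "int n dvd q - int p" "int n dvd (q - 1) - (int p - 1)"
      using b by (simp_all add: p_def algebra_simps mod_eq_dvd_iff[symmetric] flip: diff_diff_eq)
    have "f ` {1..n} = {1..n}" using finj fmaps by (intro endo_inj_surj) auto
    then obtain p' where "p' \<in> {1..n}" "p = f p'" using p by blast
    moreover obtain r where "r < n" "p' = orb_pos r"
      using \<open>p' \<in> {1..n}\<close> orb(1) unfolding bij_betw_def orb_pos_def by blast
    ultimately have "final n M ?w (int p) = M (int p - 1) - 1" using base by simp
    then show ?thesis
      using state_cong[OF state_final[OF n M] dv(1)] state_cong[OF M dv(2)] by simp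
  qed
  have cl: "closed_word n M ?w"
    using M closed by (simp add: closed_word_def map_fst_labelled)
  have "diagram n j k = concat (map (\<lambda>r. fst (pass ?W 0 (orb_pos r))) [0..<n])"
    by (simp add: diagram_def trace_eq_concat f_def orb_pos_def)
  also have "\<dots> = code n all_over (events n M ?w)"
    unfolding code_def
    by (intro arg_cong[of _ _ concat] map_cong refl)
      (use pc(1)[OF M orb_mem] MP in \<open>simp add: residue_def\<close>)
  finally have diag: "diagram n j k = code n all_over (events n M ?w)" .
  show thesis
    by (rule that[of M ?w "\<lambda>r. int (V (orb_pos r))"]) (use cl MP diag in \<open>simp_all add: length_labelled ms_def length_classical_part\<close>)
qed

theorem theorem3p2:
  fixes i j k :: nat
  assumes "j > 0" and "k < i" and "one_component i j k"
  shows "virtually_null_homotopic (diagram i j k) \<and>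
         real (vu (diagram i j k)) = real ((i - 1) * (j - 1) + k) / 2"
proof (cases "i = 1")
  \<comment> \<open>With one strand the periodic exchange is no involution, but there are no
    crossings.\<close>
  case True
  have "diagram i j k = []"
    using True assms(2) by (simp add: diagram_def trace_eq_concat braid_word_eq classical_part_def)
  moreover have "vu [] = 0" using unk.triv by (simp add: vu_def)
  ultimately show ?thesis
    using True assms(2) unk.triv by (auto simp: virtually_null_homotopic_def)
next
  case False
  with assms(2) have n: "2 \<le> i" by simp
  obtain M P w where *: "closed_word i M w" "\<forall>r<i. M (P r) = int r"
    "diagram i j k = code i all_over (events i M w)" "length w = (i - 1) * (j - 1) + k"
    by (rule diagram_closed_word[OF n assms(2,3)])
  note vu = vu_closed_word[OF n *(1), of P, OF *(2)[rule_format]]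
  have "2 * vu (diagram i j k) = (i - 1) * (j - 1) + k"
    using vu(2) *(3,4) by simp
  moreover have "real x = real y / 2" if "2 * x = y" for x y :: nat
    using that by auto
  ultimately have "real (vu (diagram i j k)) = real ((i - 1) * (j - 1) + k) / 2" by blast
  then show ?thesis using vu(1) *(3) by simp
qed

end
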